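(* Let $q$ be a prime power and $n\ge1$. Let $\mathcal{I}_k$ be the set of monic irreducible polynomials of degree $k$ in $\mathbb{F}_q[X]$ with nonzero constant term and $I_k=|\mathcal{I}_k|$. Consider the following construction of a set $\mathcal{P}_n$ of polynomials: start with $\mathcal{P}_n=\mathcal{I}_n$; then for each $1\le k\le\lfloor n/2\rfloor$, form a set $\mathcal{P}'_k$ by multiplying each polynomial in $\mathcal{I}_k$ by a distinct polynomial in $\mathcal{I}_{n-k}$ (an injective assignment $\mathcal{I}_k\to\mathcal{I}_{n-k}$), and add $\mathcal{P}'_k$ to $\mathcal{P}_n$. Let $D_n$ be the number of distinct sets $\mathcal{P}_n$ that this construction can produce. Let $S_n$ be the set of monic degree-$n$ polynomials in $\mathbb{F}_q[X]$ with nonzero constant term, $N_n$ the maximum cardinality of a subset of $S_n$ consisting of pairwise coprime polynomials, and $T_n$ the number of subsets of $S_n$ of pairwise coprime polynomials having cardinality $N_n$. Then for all $n$, $$D_n=\prod_{k=1}^{\lceil n/2-1\rceil}\frac{I_{n-k}!}{(I_{n-k}-I_k)!},$$ and as $n\to\infty$, $$\log_q D_n=\Theta(q^{n/2}),\qquad \log_q T_n=\log_q D_n+\mathcal{O}(q^{n/3})=\Theta(q^{n/2}).$$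
   Context: By a previous result of the paper, $I_{n-k}\ge I_k$ for $k\le\lfloor n/2\rfloor$, so the injective assignments in the construction exist, and the resulting $\mathcal{P}_n$ consists of pairwise coprime polynomials and has the maximum size $N_n$.
   Formalization: D_n counts only those produced sets that are pairwise coprime and of maximum size N_n; for even n this forces the assignment at k=n/2 to be the identity. Otherwise the formula fails: for q=3, n=2 the construction gives two sets, the product gives 1. *)

theory Defs
  imports
    Complex_Main
    "HOL-Computational_Algebra.Polynomial"
    "HOL-Library.Cardinality"
    "HOL-Library.Landau_Symbols"
begin

text \<open>
  The field with \<open>q\<close> elements is a type \<open>'a\<close> of sort \<open>{finite, field}\<close> with \<open>CARD('a) = q\<close>.
\<close>

definition irr_polys :: "nat \<Rightarrow> 'a::{finite, field} poly set" where
  "irr_polys k = {f. irreducible f \<and> lead_coeff f = 1 \<and> degree f = k \<and> coeff f 0 \<noteq> 0}"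

definition num_irr :: "'a::{finite, field} itself \<Rightarrow> nat \<Rightarrow> nat" where
  "num_irr _ k = card (irr_polys k :: 'a poly set)"

definition monic_polys :: "nat \<Rightarrow> 'a::{finite, field} poly set" where
  "monic_polys n = {f. lead_coeff f = 1 \<and> degree f = n \<and> coeff f 0 \<noteq> 0}"

definition max_coprime_card :: "'a::{finite, field} itself \<Rightarrow> nat \<Rightarrow> nat" where
  "max_coprime_card _ n =
     Max (card ` {A :: 'a poly set. A \<subseteq> monic_polys n \<and> pairwise coprime A})"

definition max_coprime_sets :: "nat \<Rightarrow> 'a::{finite, field} poly set set" where
  "max_coprime_sets n =
     {A. A \<subseteq> monic_polys n \<and> pairwise coprime A \<and> card A = max_coprime_card TYPE('a) n}"

definition num_max_coprime_sets :: "'a::{finite, field} itself \<Rightarrow> nat \<Rightarrow> nat" where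
  "num_max_coprime_sets _ n = card (max_coprime_sets n :: 'a poly set set)"

definition valid_assignment ::
    "nat \<Rightarrow> (nat \<Rightarrow> 'a::{finite, field} poly \<Rightarrow> 'a poly) \<Rightarrow> bool" where
  "valid_assignment n \<phi> \<longleftrightarrow>
     (\<forall>k\<in>{1..n div 2}. inj_on (\<phi> k) (irr_polys k) \<and> \<phi> k ` irr_polys k \<subseteq> irr_polys (n - k))"

definition construct ::
    "nat \<Rightarrow> (nat \<Rightarrow> 'a::{finite, field} poly \<Rightarrow> 'a poly) \<Rightarrow> 'a poly set" where
  "construct n \<phi> = irr_polys n \<union> (\<Union>k\<in>{1..n div 2}. (\<lambda>f. f * \<phi> k f) ` irr_polys k)"

text \<open>
  The construction is meant to output pairwise coprime sets of maximum size. For \<open>k < n / 2\<close> every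
  injective assignment is suitable. For \<open>k = n / 2\<close>, however, \<open>\<phi> k\<close> is a permutation of
  \<open>irr_polys k\<close>, and any permutation other than the identity gives products that share a factor or
  coincide (for instance, \<open>f \<mapsto> g \<mapsto> f\<close> yields \<open>f * g\<close> twice). Membership in
  \<open>max_coprime_sets n\<close> excludes these.
\<close>

definition constructed_sets :: "nat \<Rightarrow> 'a::{finite, field} poly set set" where
  "constructed_sets n = {construct n \<phi> |\<phi>. valid_assignment n \<phi>} \<inter> max_coprime_sets n"

definition num_constructed_sets :: "'a::{finite, field} itself \<Rightarrow> nat \<Rightarrow> nat" where
  "num_constructed_sets _ n = card (constructed_sets n :: 'a poly set set)"

end

theory Submission
  imports
    Defs
    "HOL-Computational_Algebra.Polynomial_Factorial"
    "HOL-Library.FuncSet"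
begin

text \<open>
  Every polynomial in a pairwise coprime set \<open>A\<close> of degree-\<open>n\<close> polynomials is irreducible or has an
  irreducible factor of degree at most \<open>n / 2\<close>, and these factors are distinct for distinct elements of
  \<open>A\<close>. If \<open>A\<close> has maximum size, every such irreducible polynomial \<open>p\<close> therefore divides exactly one element, and
  \<open>p\<close> is the only factor of that element of degree at most \<open>n / 2\<close>. For \<open>n / 3 < deg p < n / 2\<close> this forces the
  element to be \<open>p * g\<close> with \<open>g\<close> irreducible, as in the construction. Hence the construction misses a
  factor of at most \<open>q ^ (n * \<Sum>\<^sub>k I\<^sub>k)\<close>, where \<open>k \<le> n / 3\<close>, and this exponent is \<open>O(q ^ (n / 3))\<close> because
  \<open>k I\<^sub>k \<le> q ^ k\<close>. The factor of \<open>D\<^sub>n\<close> with the largest \<open>k\<close> is at least \<open>I\<^sub>k!\<close>, which gives the lower bound.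
\<close>

subsection \<open>Polynomials with nonzero constant term\<close>

text \<open>The threshold n / 3 comes from the cofactor of \<open>p\<close>: a reducible cofactor of
  degree n - k has an irreducible factor of degree at most (n - k) / 2, which is below k exactly
  when n < 3 k, and that factor would be a second small divisor of the same element. That every
  small irreducible occurs exactly once rests on the maximum size being the number of irreducibles
  of degree n or at most n / 2. This size is attained only because injective assignments exist, that
  is, because I_k <= I_{n-k}. Rough asymptotics for I_k cannot give this inequality for all k and q
  (for q = 2 there is no slack: I_1 = I_2 = 1), so it is derived from an exact formula for the sum
  of d I_d over the divisors d of n. In the lower bound, I_k is of order q^k / k and ln (I_k!) is
  about I_k ln I_k; the factor ln I_k is of order k and cancels the denominator, which leaves q^k
  without a logarithmic loss.\<close>

lemma irr_polysD:
  assumes "p \<in> irr_polys k"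
  shows "prime_elem p" "p \<in> monic_polys k" "0 < k"
proof -
  show "prime_elem p"
    using assms by (simp add: irr_polys_def field_poly_irreducible_imp_prime)
  then show "0 < k"
    using assms by (auto simp: irr_polys_def prime_elem_def is_unit_iff_degree intro: Nat.gr0I)
  show "p \<in> monic_polys k"
    using assms by (auto simp: irr_polys_def monic_polys_def)
qed

lemma degree_monic_polys: "f \<in> monic_polys n \<Longrightarrow> degree f = n"
  by (simp add: monic_polys_def)

lemma monic_polys_nonzero: "f \<in> monic_polys n \<Longrightarrow> f \<noteq> 0"
  by (auto simp: monic_polys_def)

lemma monic_polys_mult:
  assumes "f \<in> monic_polys m" "g \<in> monic_polys n"
  shows "f * g \<in> monic_polys (m + n)"
proof -
  have "f \<noteq> 0" "g \<noteq> 0"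
    using assms by (auto simp: monic_polys_nonzero)
  with assms show ?thesis
    by (auto simp: monic_polys_def degree_mult_eq lead_coeff_mult coeff_mult_degree_sum coeff_mult_0)
qed

lemma monic_polys_cofactor:
  assumes "f * g \<in> monic_polys n" "f \<in> monic_polys m"
  shows "m \<le> n" "g \<in> monic_polys (n - m)"
proof -
  have nz: "f \<noteq> 0" "g \<noteq> 0"
    using monic_polys_nonzero[OF assms(1)] by auto
  then have "degree f + degree g = n"
    using assms(1) by (simp add: monic_polys_def degree_mult_eq)
  with assms(2) show "m \<le> n" and "g \<in> monic_polys (n - m)"
    using assms(1) lead_coeff_mult[of f g] by (auto simp: monic_polys_def coeff_mult_0)
qed

lemma monic_polys_0: "monic_polys 0 = {1}"
  by (auto simp: monic_polys_def elim!: degree_eq_zeroE)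

lemma monic_polys_dvd_same_degree:
  assumes "f dvd g" "f \<in> monic_polys n" "g \<in> monic_polys n"
  shows "f = g"
proof -
  from assms(1) obtain h where h: "g = f * h" ..
  with assms monic_polys_cofactor(2)[of f h n n] have "h \<in> monic_polys 0"
    by simp
  with h show ?thesis by (simp add: monic_polys_0)
qed

lemma irr_polys_dvd_eq:
  assumes "p \<in> irr_polys d" "r \<in> irr_polys e" "p dvd r"
  shows "p = r"
proof -
  from assms(3) obtain h where h: "r = p * h" ..
  have "irreducible r"
    using assms(2) by (simp add: irr_polys_def)
  moreover have "\<not> p dvd 1"
    using irr_polysD(1)[OF assms(1)] by (simp add: prime_elem_def)
  ultimately have "h dvd 1"
    using h irreducibleD by blast
  moreover have hS: "h \<in> monic_polys (e - d)"
    using monic_polys_cofactor(2)[of p h e d] h irr_polysD(2) assms by auto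
  ultimately have "degree h = 0"
    using is_unit_iff_degree monic_polys_nonzero by blast
  with hS have "h \<in> monic_polys 0"
    by (simp add: degree_monic_polys)
  then have "h = 1"
    by (simp add: monic_polys_0)
  with h show ?thesis by simp
qed

text \<open>A factorisation into non-units is rescaled by \<open>c\<close> and its inverse so that
  both factors become monic. Their constant terms are nonzero because that of \<open>f\<close>
  is.\<close>

lemma monic_polys_reducible:
  assumes "f \<in> monic_polys n" "0 < n" "f \<notin> irr_polys n"
  obtains a b i j where "f = a * b" "a \<in> monic_polys i" "b \<in> monic_polys j" "0 < i" "0 < j" "n = i + j"
proof -
  have "f \<noteq> 0"
    using assms by (simp add: monic_polys_nonzero)
  moreover from this have "\<not> f dvd 1"
    using assms by (simp add: is_unit_iff_degree degree_monic_polys)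
  moreover have "\<not> irreducible f"
    using assms by (auto simp: monic_polys_def irr_polys_def)
  ultimately obtain a b where ab: "f = a * b" "\<not> a dvd 1" "\<not> b dvd 1"
    by (auto simp: irreducible_def)
  have nz: "a \<noteq> 0" "b \<noteq> 0"
    using \<open>f \<noteq> 0\<close> ab by auto
  then have pos: "0 < degree a" "0 < degree b"
    using ab by (simp_all add: is_unit_iff_degree)
  define c where "c = lead_coeff a"
  have "c \<noteq> 0"
    using nz by (simp add: c_def)
  have f: "f = smult (inverse c) a * smult c b"
    using ab(1) \<open>c \<noteq> 0\<close> by simp
  have "coeff a 0 \<noteq> 0"
    using assms(1) ab(1) by (auto simp: monic_polys_def coeff_mult_0)
  then have a: "smult (inverse c) a \<in> monic_polys (degree a)"
    using \<open>c \<noteq> 0\<close> by (simp add: monic_polys_def c_def)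
  have "n = degree a + degree b"
    using assms(1) ab(1) nz by (simp add: monic_polys_def degree_mult_eq)
  moreover have "smult c b \<in> monic_polys (n - degree a)"
    using monic_polys_cofactor(2) a f assms(1) by metis
  ultimately show ?thesis
    using that[OF f a, of "degree b"] pos by simp
qed

lemma irr_divisor_exists:
  assumes "f \<in> monic_polys n" "0 < n"
  obtains d p where "d \<le> n" "p \<in> irr_polys d" "p dvd f"
  using assms
proof (induction n arbitrary: f thesis rule: less_induct)
  case (less n)
  show ?case
  proof (cases "f \<in> irr_polys n")
    case True
    then show ?thesis using less.prems(1)[of n f] by simp
  next
    case False
    then obtain a b i j where *: "f = a * b" "a \<in> monic_polys i" "0 < i" "0 < j" "n = i + j"
      using monic_polys_reducible less.prems by metis
    obtain d p where "d \<le> i" "p \<in> irr_polys d" "p dvd a"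
      using less.IH[of i a] * by auto
    with * show ?thesis
      using less.prems(1)[of d p] by auto
  qed
qed

lemma small_irr_divisor_exists:
  assumes "f \<in> monic_polys n" "0 < n" "f \<notin> irr_polys n"
  obtains d p where "d \<le> n div 2" "p \<in> irr_polys d" "p dvd f"
proof -
  obtain a b i j where *: "f = a * b" "a \<in> monic_polys i" "b \<in> monic_polys j"
      "0 < i" "0 < j" "n = i + j"
    using monic_polys_reducible assms by metis
  show ?thesis
  proof (cases "i \<le> j")
    case True
    obtain d p where "d \<le> i" "p \<in> irr_polys d" "p dvd a"
      using irr_divisor_exists * by metis
    with * True show ?thesis using that[of d p] by auto
  next
    case False
    obtain d p where "d \<le> j" "p \<in> irr_polys d" "p dvd b"
      using irr_divisor_exists * by metis
    with * False show ?thesis using that[of d p] by auto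
  qed
qed

section \<open>Counting monic polynomials and their multiples\<close>

lemma bij_betw_pCons_monic_polys:
  "bij_betw (\<lambda>(c, f). pCons c f) ((UNIV - {0}) \<times> {f. lead_coeff f = 1 \<and> degree f = n})
     (monic_polys (Suc n))"
proof -
  have "f \<in> (\<lambda>(c, f). pCons c f) ` ((UNIV - {0}) \<times> {f. lead_coeff f = 1 \<and> degree f = n})"
    if "f \<in> monic_polys (Suc n)" for f :: "'a poly"
  proof (cases f)
    case (pCons c g)
    with that show ?thesis
      by (auto simp: monic_polys_def split: if_splits)
  qed
  then show ?thesis
    by (auto simp: bij_betw_def inj_on_def monic_polys_def)
qed

lemma bij_betw_pCons_monic:
  "bij_betw (\<lambda>(c, f). pCons c f) (UNIV \<times> {f. lead_coeff f = 1 \<and> degree f = n})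
     {f :: 'a::field poly. lead_coeff f = 1 \<and> degree f = Suc n}"
proof -
  have "f \<in> (\<lambda>(c, f). pCons c f) ` (UNIV \<times> {f. lead_coeff f = 1 \<and> degree f = n})"
    if "lead_coeff f = 1 \<and> degree f = Suc n" for f :: "'a poly"
  proof (cases f)
    case (pCons c g)
    with that show ?thesis
      by (auto split: if_splits)
  qed
  then show ?thesis
    by (auto simp: bij_betw_def inj_on_def)
qed

lemma card_monic_degree:
  "card {f :: 'a::{finite, field} poly. lead_coeff f = 1 \<and> degree f = n} = CARD('a) ^ n
   \<and> finite {f :: 'a poly. lead_coeff f = 1 \<and> degree f = n}"
proof (induction n)
  case 0
  have "{f :: 'a poly. lead_coeff f = 1 \<and> degree f = 0} = {1}"
    by (auto elim!: degree_eq_zeroE)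
  then show ?case by simp
next
  case (Suc n)
  then show ?case
    using bij_betw_same_card[OF bij_betw_pCons_monic[of n, where 'a = 'a]]
      bij_betw_finite[OF bij_betw_pCons_monic[of n, where 'a = 'a]]
    by (simp add: card_cartesian_product)
qed

text \<open>Removing the constant coefficient, one of \<open>q - 1\<close> values, leaves an
  arbitrary monic polynomial of degree \<open>n\<close>, whose own constant term may vanish. Degree
  0 does not fit the pattern: \<open>monic_polys 0\<close> is a singleton.\<close>

lemma card_monic_polys_Suc:
  "card (monic_polys (Suc n) :: 'a::{finite, field} poly set) = (CARD('a) - 1) * CARD('a) ^ n"
proof -
  have "card (monic_polys (Suc n) :: 'a poly set)
      = card ((UNIV - {0 :: 'a}) \<times> {f :: 'a poly. lead_coeff f = 1 \<and> degree f = n})"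
    by (rule bij_betw_same_card[OF bij_betw_pCons_monic_polys, symmetric])
  also have "\<dots> = (CARD('a) - 1) * CARD('a) ^ n"
    unfolding card_cartesian_product conjunct1[OF card_monic_degree] by (simp add: card_Diff_singleton)
  finally show ?thesis .
qed

lemma finite_monic_polys [simp]: "finite (monic_polys n :: 'a::{finite, field} poly set)"
  by (rule finite_subset[OF _ conjunct2[OF card_monic_degree[of n]]]) (auto simp: monic_polys_def)

lemma finite_irr_polys [simp]: "finite (irr_polys n)"
  using irr_polysD(2) by (blast intro: finite_subset[OF _ finite_monic_polys])

lemma card_multiples:
  fixes r :: "'a::{finite, field} poly"
  assumes "r \<in> monic_polys e" "e \<le> n"
  shows "card {f \<in> monic_polys n. r dvd f} = card (monic_polys (n - e) :: 'a poly set)"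
proof -
  have "{f \<in> monic_polys n. r dvd f} = (*) r ` monic_polys (n - e)"
    using monic_polys_cofactor(2)[of r _ n e] monic_polys_mult[of r e _ "n - e"] assms
    by (auto elim!: dvdE)
  moreover have "inj_on ((*) r) (monic_polys (n - e))"
    using monic_polys_nonzero[OF assms(1)] by (auto simp: inj_on_def)
  ultimately show ?thesis by (simp only: card_image)
qed

lemma no_multiples:
  assumes "r \<in> monic_polys e" "n < e"
  shows "{f \<in> monic_polys n. r dvd f} = {}"
  using monic_polys_cofactor(1)[of r _ n e] assms by (fastforce elim: dvdE)

lemma monic_polys_power: "f \<in> monic_polys d \<Longrightarrow> f ^ j \<in> monic_polys (j * d)"
  by (induction j) (auto simp: monic_polys_0 monic_polys_mult)

subsection \<open>The number of irreducible polynomials\<close>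

lemma irr_power_dvd_exponent_le:
  assumes "p \<in> irr_polys d" "f \<in> monic_polys n" "p ^ j dvd f"
  shows "j \<le> n"
proof -
  obtain g where g: "f = p ^ j * g"
    using assms(3) ..
  have "j * d \<le> n"
    using monic_polys_cofactor(1)[of "p ^ j" g n "j * d"] assms g
    by (simp add: monic_polys_power irr_polysD)
  moreover have "j \<le> j * d"
    using irr_polysD(3)[OF assms(1)] by simp
  ultimately show ?thesis by linarith
qed

lemma power_dvd_irr_mult_iff:
  assumes "p \<in> irr_polys d" "r \<in> irr_polys e" "p \<noteq> r"
  shows "p ^ j dvd r * g \<longleftrightarrow> p ^ j dvd g"
proof -
  have "\<not> p dvd r"
    using irr_polys_dvd_eq assms by blast
  show ?thesis
  proof
    assume "p ^ j dvd r * g"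
    then obtain x y where "x + y = j" "p ^ x dvd r" "p ^ y dvd g"
      using prime_elem_power_dvd_prod[OF _ irr_polysD(1)[OF assms(1)]] by blast
    moreover from this have "x = 0"
      using \<open>\<not> p dvd r\<close> by (cases x) (auto dest: dvd_mult_left)
    ultimately show "p ^ j dvd g" by simp
  qed simp
qed

text \<open>The cardinality is the multiplicity of \<open>p\<close>. For \<open>p = r\<close> the
  exponents shift by one, since \<open>p ^ Suc i\<close> divides \<open>r * g\<close> iff
  \<open>p ^ i\<close> divides \<open>g\<close>; the bound \<open>m + e \<le> N\<close> keeps the
  shifted exponents within range.\<close>

lemma card_power_dvd_irr_mult:
  assumes "p \<in> irr_polys d" "r \<in> irr_polys e" "g \<in> monic_polys m" "m + e \<le> N"
  shows "card {j \<in> {1..N}. p ^ j dvd r * g} = card {j \<in> {1..N}. p ^ j dvd g} + of_bool (p = r)"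
proof (cases "p = r")
  case True
  have "m + 1 \<le> N"
    using assms(4) irr_polysD(3)[OF assms(2)] by linarith
  have "{j \<in> {1..N}. p ^ j dvd r * g} = Suc ` {j \<in> {0..N}. p ^ j dvd g}"
  proof (rule set_eqI)
    fix j
    show "j \<in> {j \<in> {1..N}. p ^ j dvd r * g} \<longleftrightarrow> j \<in> Suc ` {j \<in> {0..N}. p ^ j dvd g}"
    proof (cases j)
      case (Suc i)
      have "p ^ i dvd g \<Longrightarrow> Suc i \<le> N"
        using irr_power_dvd_exponent_le[OF assms(1,3)] \<open>m + 1 \<le> N\<close> by fastforce
      moreover have "p \<noteq> 0"
        using assms(1) irr_polysD(1) by force
      ultimately show ?thesis
        using Suc True by (auto simp: image_iff)
    qed auto
  qed
  then have "card {j \<in> {1..N}. p ^ j dvd r * g} = card {j \<in> {0..N}. p ^ j dvd g}"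
    by (simp add: card_image)
  also have "{j \<in> {0..N}. p ^ j dvd g} = insert 0 {j \<in> {1..N}. p ^ j dvd g}"
    by (auto simp: Suc_le_eq)
  also have "card \<dots> = card {j \<in> {1..N}. p ^ j dvd g} + 1"
    by simp
  finally show ?thesis
    using True by simp
next
  case False
  then show ?thesis
    by (simp add: power_dvd_irr_mult_iff[OF assms(1,2)])
qed

text \<open>The degree is the sum of the degrees of the irreducible factors with multiplicity.
  \<open>N\<close> is separate from \<open>n\<close> so that the induction can pass to a cofactor of
  lower degree without changing the ranges of the sums.\<close>

lemma sum_degree_irr_powers:
  assumes "f \<in> monic_polys n" "n \<le> N"
  shows "(\<Sum>d=1..N. \<Sum>p\<in>irr_polys d. d * card {j \<in> {1..N}. p ^ j dvd f}) = n"
  using assms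
proof (induction n arbitrary: f rule: less_induct)
  case (less n)
  show ?case
  proof (cases "n = 0")
    case True
    then have "f = 1"
      using less.prems by (simp add: monic_polys_0)
    have "{j \<in> {1..N}. p ^ j dvd f} = {}" if "p \<in> irr_polys d" for p and d
      using irr_power_dvd_exponent_le[OF that less.prems(1)] True by fastforce
    then show ?thesis
      using True by simp
  next
    case False
    then obtain e r where er: "e \<le> n" "r \<in> irr_polys e" "r dvd f"
      using irr_divisor_exists[OF less.prems(1)] by auto
    obtain g where g: "f = r * g"
      using er(3) ..
    have gS: "g \<in> monic_polys (n - e)"
      using monic_polys_cofactor(2)[of r g n e] irr_polysD(2)[OF er(2)] g less.prems by simp
    have "(\<Sum>d=1..N. \<Sum>p\<in>irr_polys d. d * card {j \<in> {1..N}. p ^ j dvd f})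
        = (\<Sum>d=1..N. \<Sum>p\<in>irr_polys d. d * card {j \<in> {1..N}. p ^ j dvd g} + d * of_bool (p = r))"
    proof (intro sum.cong refl)
      fix d p assume "p \<in> (irr_polys d :: 'a poly set)"
      then show "d * card {j \<in> {1..N}. p ^ j dvd f}
          = d * card {j \<in> {1..N}. p ^ j dvd g} + d * of_bool (p = r)"
        using card_power_dvd_irr_mult[of p d r e g "n - e" N] er gS g less.prems(2)
        by (simp add: algebra_simps)
    qed
    also have "\<dots> = (\<Sum>d=1..N. \<Sum>p\<in>irr_polys d. d * card {j \<in> {1..N}. p ^ j dvd g})
        + (\<Sum>d=1..N. \<Sum>p\<in>irr_polys d. d * of_bool (p = r))"
      by (simp add: sum.distrib)
    also have "(\<Sum>d=1..N. \<Sum>p\<in>irr_polys d. d * card {j \<in> {1..N}. p ^ j dvd g}) = n - e"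
      using less.IH[of "n - e" g] gS irr_polysD(3)[OF er(2)] False less.prems(2) by simp
    also have "(\<Sum>d=1..N. \<Sum>p\<in>irr_polys d. d * of_bool (p = r)) = (\<Sum>d=1..N. if d = e then e else 0)"
    proof (intro sum.cong refl)
      fix d
      have "r \<in> irr_polys d \<longleftrightarrow> d = e"
        using er(2) by (auto simp: irr_polys_def)
      moreover have "(\<Sum>p\<in>irr_polys d. d * of_bool (p = r)) = (\<Sum>p\<in>irr_polys d. if p = r then d else 0)"
        by (intro sum.cong) auto
      ultimately show "(\<Sum>p\<in>irr_polys d. d * of_bool (p = r)) = (if d = e then e else 0)"
        by (simp add: sum.delta)
    qed
    also have "\<dots> = e"
      using er(1) irr_polysD(3)[OF er(2)] less.prems(2) by (simp add: sum.delta)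
    finally show ?thesis
      using er(1) by simp
  qed
qed

lemma sum_card_eq_swap:
  assumes "finite A" "finite B"
  shows "(\<Sum>x\<in>A. card {y \<in> B. P x y}) = (\<Sum>y\<in>B. card {x \<in> A. P x y})"
  using sum_multicount_gen[of A B "\<lambda>x y. P x y" "\<lambda>y. card {x \<in> A. P x y}"] assms by simp

text \<open>
  Summing the degree \<open>n = \<Sum>\<^sub>p deg p * |{j \<ge> 1. p ^ j dvd f}|\<close> over all \<open>f\<close> is a polynomial analogue
  of Chebyshev's identity \<open>ln n! = \<Sum>\<^sub>m \<Lambda>(m) \<lfloor>n / m\<rfloor>\<close>; it avoids the splitting field of \<open>X^(q^n) - X\<close>.
\<close>

lemma degree_count:
  "n * card (monic_polys n :: 'a::{finite, field} poly set)
    = (\<Sum>m=1..n. card (monic_polys (n - m) :: 'a poly set) *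
        (\<Sum>d\<in>{d \<in> {1..n}. d dvd m}. d * num_irr TYPE('a) d))"
proof -
  let ?S = "monic_polys :: nat \<Rightarrow> 'a poly set" and ?I = "irr_polys :: nat \<Rightarrow> 'a poly set"
  \<comment> \<open>Substituting \<open>m = j * d\<close> makes the weight depend on
    \<open>m\<close> alone, so that the sums over \<open>d\<close> and \<open>m\<close> can be
    exchanged.\<close>
  have inner: "(\<Sum>j=1..n. if j * d \<le> n then card (?S (n - j * d)) else 0)
      = (\<Sum>m=1..n. if d dvd m then card (?S (n - m)) else 0)"
    if d: "d \<in> {1..n}" for d
  proof -
    have "(\<Sum>j=1..n. if j * d \<le> n then card (?S (n - j * d)) else 0)
        = (\<Sum>j\<in>{j \<in> {1..n}. j * d \<le> n}. card (?S (n - j * d)))"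
      by (simp only: sum.inter_filter finite_atLeastAtMost)
    also have "\<dots> = (\<Sum>m\<in>{m \<in> {1..n}. d dvd m}. card (?S (n - m)))"
    proof (rule sum.reindex_bij_witness[of _ "\<lambda>m. m div d" "\<lambda>j. j * d"], goal_cases)
      case (4 m)
      then obtain k where k: "m = d * k" by auto
      have "k \<le> d * k" using d by simp
      also have "\<dots> \<le> n" using 4 k by simp
      finally have "k \<le> n" .
      then show ?case using 4 k d by (auto simp: mult.commute)
    next
      case (3 m)
      then show ?case by auto
    qed (use d in \<open>auto elim!: dvdE\<close>)
    also have "\<dots> = (\<Sum>m=1..n. if d dvd m then card (?S (n - m)) else 0)"
      by (simp only: sum.inter_filter finite_atLeastAtMost)
    finally show ?thesis .
  qed
  have "n * card (?S n) = (\<Sum>f\<in>?S n. n)"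
    by simp
  also have "\<dots> = (\<Sum>f\<in>?S n. \<Sum>d=1..n. \<Sum>p\<in>?I d. d * card {j \<in> {1..n}. p ^ j dvd f})"
    by (intro sum.cong refl sum_degree_irr_powers[symmetric]) auto
  also have "\<dots> = (\<Sum>d=1..n. \<Sum>f\<in>?S n. \<Sum>p\<in>?I d. d * card {j \<in> {1..n}. p ^ j dvd f})"
    by (rule sum.swap)
  also have "\<dots> = (\<Sum>d=1..n. \<Sum>p\<in>?I d. \<Sum>f\<in>?S n. d * card {j \<in> {1..n}. p ^ j dvd f})"
    by (intro sum.cong refl sum.swap)
  also have "\<dots> = (\<Sum>d=1..n. \<Sum>p\<in>?I d. d * (\<Sum>j=1..n. card {f \<in> ?S n. p ^ j dvd f}))"
    by (simp only: sum_distrib_left[symmetric] sum_card_eq_swap[OF finite_monic_polys finite_atLeastAtMost])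
  also have "\<dots> = (\<Sum>d=1..n. \<Sum>p\<in>?I d. d * (\<Sum>j=1..n. if j * d \<le> n then card (?S (n - j * d)) else 0))"
  proof (intro sum.cong refl arg_cong2[of _ _ _ _ "(*)"])
    fix d p j assume "p \<in> ?I d"
    then have "p ^ j \<in> ?S (j * d)"
      by (intro monic_polys_power irr_polysD)
    then show "card {f \<in> ?S n. p ^ j dvd f} = (if j * d \<le> n then card (?S (n - j * d)) else 0)"
      by (simp add: card_multiples no_multiples)
  qed
  also have "\<dots> = (\<Sum>d=1..n. d * num_irr TYPE('a) d *
      (\<Sum>j=1..n. if j * d \<le> n then card (?S (n - j * d)) else 0))"
    by (simp add: num_irr_def mult_ac)
  also have "\<dots> = (\<Sum>d=1..n. d * num_irr TYPE('a) d * (\<Sum>m=1..n. if d dvd m then card (?S (n - m)) else 0))"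
    by (rule sum.cong[OF refl]) (simp only: inner)
  also have "\<dots> = (\<Sum>d=1..n. \<Sum>m=1..n. if d dvd m then card (?S (n - m)) * (d * num_irr TYPE('a) d) else 0)"
    unfolding sum_distrib_left by (intro sum.cong refl) simp
  also have "\<dots> = (\<Sum>m=1..n. \<Sum>d=1..n. if d dvd m then card (?S (n - m)) * (d * num_irr TYPE('a) d) else 0)"
    by (rule sum.swap)
  also have "\<dots> = (\<Sum>m=1..n. card (?S (n - m)) * (\<Sum>d\<in>{d \<in> {1..n}. d dvd m}. d * num_irr TYPE('a) d))"
    by (simp only: sum.inter_filter finite_atLeastAtMost sum_distrib_left if_distrib[of "(*) _"] mult_0_right)
  finally show ?thesis .
qed

lemma card_field_ge_2: "2 \<le> CARD('a::{finite, field})"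
proof -
  have "card {0, 1 :: 'a} \<le> CARD('a)"
    by (intro card_mono) auto
  then show ?thesis by simp
qed

text \<open>
  The usual \<open>q ^ n\<close> is lowered by one because the irreducible polynomial \<open>X\<close> is excluded.
\<close>

theorem sum_divisors_num_irr:
  assumes "0 < n"
  shows "(\<Sum>d | d dvd n. d * num_irr TYPE('a::{finite, field}) d) = CARD('a) ^ n - 1"
  using assms
proof (induction n rule: less_induct)
  case (less n)
  define q where "q = CARD('a)"
  define L where "L m = (\<Sum>d | d dvd m. d * num_irr TYPE('a) d)" for m
  have "2 \<le> q"
    by (simp add: q_def card_field_ge_2)
  have S: "int (card (monic_polys (Suc k) :: 'a poly set)) = (int q - 1) * int q ^ k" for k
    using \<open>2 \<le> q\<close> unfolding card_monic_polys_Suc q_def[symmetric] by (simp add: of_nat_diff)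
  obtain k where k: "n = Suc k"
    using less.prems by (cases n) auto
  have divisors: "{d \<in> {1..n}. d dvd m} = {d. d dvd m}" if "m \<in> {1..n}" for m
    using that by (auto simp: Suc_le_eq dest: dvd_imp_le intro: dvd_pos_nat)
  \<comment> \<open>The counting identity is solved for \<open>L n\<close>, as \<open>L m\<close> is
    known for smaller \<open>m\<close>.\<close>
  have "n * card (monic_polys n :: 'a poly set) = (\<Sum>m=1..n. card (monic_polys (n - m) :: 'a poly set) * L m)"
    unfolding degree_count by (intro sum.cong refl) (simp only: L_def divisors)
  \<comment> \<open>For \<open>m = n\<close> the weight is \<open>card (monic_polys 0) = 1\<close>,
    to which the formula \<open>S\<close> does not apply.\<close>
  also have "{1..n} = insert n {1..k}"
    using k by auto
  also have "(\<Sum>m\<in>insert n {1..k}. card (monic_polys (n - m) :: 'a poly set) * L m)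
      = L n + (\<Sum>m=1..k. card (monic_polys (n - m) :: 'a poly set) * L m)"
    using k by (simp add: monic_polys_0)
  finally have "int (n * card (monic_polys n :: 'a poly set))
      = int (L n) + (\<Sum>m=1..k. int (card (monic_polys (n - m) :: 'a poly set)) * int (L m))"
    by simp
  \<comment> \<open>The product \<open>(q - 1) * q ^ (k - m)\<close> is written as a difference of
    consecutive powers, so that its sum telescopes.\<close>
  also have "(\<Sum>m=1..k. int (card (monic_polys (n - m) :: 'a poly set)) * int (L m))
      = (\<Sum>m=1..k. (int q - 1) * int q ^ k - (int q ^ (Suc k - m) - int q ^ (k - m)))"
  proof (intro sum.cong refl)
    fix m assume m: "m \<in> {1..k}"
    have "L m = q ^ m - 1"
      using less.IH[of m] m k by (simp add: L_def q_def)
    then have L: "int (L m) = int q ^ m - 1"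
      using \<open>2 \<le> q\<close> by (simp add: of_nat_diff)
    have "n - m = Suc (k - m)" and *: "int q ^ k = int q ^ m * int q ^ (k - m)"
      using m k by (auto simp flip: power_add)
    then show "int (card (monic_polys (n - m) :: 'a poly set)) * int (L m)
        = (int q - 1) * int q ^ k - (int q ^ (Suc k - m) - int q ^ (k - m))"
      using m unfolding L * by (simp add: S Suc_diff_le algebra_simps)
  qed
  also have "\<dots> = int k * ((int q - 1) * int q ^ k) - (\<Sum>m=1..k. int q ^ (Suc k - m) - int q ^ (k - m))"
    by (simp add: sum_subtractf)
  also have "(\<Sum>m=1..k. int q ^ (Suc k - m) - int q ^ (k - m)) = int q ^ k - 1"
  proof -
    have "(\<Sum>m=1..k. int q ^ (Suc k - m) - int q ^ (k - m)) = (\<Sum>i<k. int q ^ Suc i - int q ^ i)"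
      by (rule sum.reindex_bij_witness[of _ "\<lambda>i. k - i" "\<lambda>m. k - m"]) (auto simp: Suc_diff_le)
    also have "\<dots> = int q ^ k - 1"
      by (simp add: sum_lessThan_telescope del: power_Suc)
    finally show ?thesis .
  qed
  finally have "int (L n) = int q ^ n - 1"
    using S[of k] k by (simp add: algebra_simps)
  then have "L n = q ^ n - 1"
    using \<open>2 \<le> q\<close> by (metis nat_int nat_minus_as_int of_nat_1 of_nat_power)
  then show ?case
    by (simp add: L_def q_def)
qed

section \<open>Bounds and monotonicity for the number of irreducible polynomials\<close>

lemma num_irr_1: "num_irr TYPE('a::{finite, field}) 1 = CARD('a) - 1"
  using sum_divisors_num_irr[of 1, where 'a = 'a] by simp

lemma num_irr_le:
  assumes "2 \<le> n"
  shows "int n * int (num_irr TYPE('a::{finite, field}) n) \<le> int CARD('a) ^ n - int CARD('a)"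
proof -
  let ?I = "num_irr TYPE('a)"
  have "?I 1 = CARD('a) - 1"
    by (rule num_irr_1)
  moreover have "(\<Sum>d\<in>{1, n}. d * ?I d) \<le> (\<Sum>d | d dvd n. d * ?I d)"
    using assms by (intro sum_mono2) auto
  ultimately have "CARD('a) - 1 + n * ?I n \<le> CARD('a) ^ n - 1"
    using assms unfolding sum_divisors_num_irr[OF order.strict_trans2[OF zero_less_numeral assms]] by simp
  moreover have "2 \<le> CARD('a)" "1 \<le> CARD('a) ^ n"
    using card_field_ge_2[where 'a = 'a] by (simp_all add: Suc_le_eq)
  ultimately have "CARD('a) + n * ?I n \<le> CARD('a) ^ n"
    by linarith
  then have "int (CARD('a) + n * ?I n) \<le> int (CARD('a) ^ n)"
    by (simp only: of_nat_le_iff)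
  then show ?thesis by simp
qed

lemma num_irr_le_power:
  assumes "0 < n"
  shows "n * num_irr TYPE('a::{finite, field}) n \<le> CARD('a) ^ n"
proof -
  have "(\<Sum>d\<in>{n}. d * num_irr TYPE('a) d) \<le> (\<Sum>d | d dvd n. d * num_irr TYPE('a) d)"
    using assms by (intro sum_mono2) auto
  then show ?thesis
    unfolding sum_divisors_num_irr[OF assms] by simp
qed

lemma sum_power_minus_1_le:
  assumes "2 \<le> (q :: int)"
  shows "(\<Sum>d=1..h. q ^ d - 1) \<le> 2 * q ^ h - 2 - int h"
proof (induction h)
  case (Suc h)
  have "2 * q ^ h \<le> q ^ Suc h"
    using assms by simp
  with Suc show ?case by simp
qed simp

text \<open>In the divisor identity the proper divisors of \<open>n\<close> are at most
  \<open>n div 2\<close>, and each contributes at most \<open>q ^ d - 1\<close>. The lower-order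
  terms are kept because the monotonicity proof is tight for \<open>q = 2\<close> and
  \<open>k = 1\<close>.\<close>

lemma num_irr_ge:
  assumes "0 < n"
  shows "int CARD('a) ^ n + 1 + int (n div 2) - 2 * int CARD('a) ^ (n div 2)
    \<le> int n * int (num_irr TYPE('a::{finite, field}) n)"
proof -
  let ?I = "num_irr TYPE('a)"
  have q: "2 \<le> CARD('a)"
    by (rule card_field_ge_2)
  have sub: "{d. d dvd n} - {n} \<subseteq> {1..n div 2}"
  proof
    fix d assume "d \<in> {d. d dvd n} - {n}"
    then have "d dvd n" "d \<noteq> n"
      by auto
    then obtain k where k: "n = d * k" by auto
    with assms \<open>d \<noteq> n\<close> have "2 \<le> k" "0 < d"
      by (auto simp: numeral_2_eq_2 Suc_le_eq intro!: Nat.gr0I)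
    with k have "d * 2 \<le> n"
      by simp
    with \<open>0 < d\<close> show "d \<in> {1..n div 2}" by simp
  qed
  have "int CARD('a) ^ n - 1 = int (\<Sum>d | d dvd n. d * ?I d)"
    using q by (simp add: sum_divisors_num_irr[OF assms] of_nat_diff)
  also have "(\<Sum>d | d dvd n. d * ?I d) = n * ?I n + (\<Sum>d\<in>{d. d dvd n} - {n}. d * ?I d)"
    using assms by (intro sum.remove) auto
  also have "int \<dots> = int n * int (?I n) + (\<Sum>d\<in>{d. d dvd n} - {n}. int (d * ?I d))"
    by simp
  also have "(\<Sum>d\<in>{d. d dvd n} - {n}. int (d * ?I d)) \<le> (\<Sum>d\<in>{d. d dvd n} - {n}. int CARD('a) ^ d - 1)"
  proof (rule sum_mono)
    fix d assume "d \<in> {d. d dvd n} - {n}"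
    with assms have "0 < d"
      by (auto intro: Nat.gr0I)
    have "(\<Sum>e\<in>{d}. e * ?I e) \<le> (\<Sum>e | e dvd d. e * ?I e)"
      using \<open>0 < d\<close> by (intro sum_mono2) auto
    then have "d * ?I d \<le> CARD('a) ^ d - 1"
      unfolding sum_divisors_num_irr[OF \<open>0 < d\<close>] by simp
    moreover have "1 \<le> CARD('a) ^ d"
      using q by (intro one_le_power) simp
    ultimately have "d * ?I d + 1 \<le> CARD('a) ^ d"
      by linarith
    then have "int (d * ?I d + 1) \<le> int (CARD('a) ^ d)"
      by (simp only: of_nat_le_iff)
    then show "int (d * ?I d) \<le> int CARD('a) ^ d - 1"
      by simp
  qed
  also have "(\<Sum>d\<in>{d. d dvd n} - {n}. int CARD('a) ^ d - 1) \<le> (\<Sum>d=1..n div 2. int CARD('a) ^ d - 1)"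
    using sub q by (intro sum_mono2) auto
  also have "\<dots> \<le> 2 * int CARD('a) ^ (n div 2) - 2 - int (n div 2)"
    using q by (intro sum_power_minus_1_le) simp
  finally show ?thesis by simp
qed

lemma num_irr_Suc_mono:
  assumes "0 < k"
  shows "num_irr TYPE('a::{finite, field}) k \<le> num_irr TYPE('a) (Suc k)"
proof -
  define q where "q = int CARD('a)"
  define a where "a = int (num_irr TYPE('a) k)"
  define b where "b = int (num_irr TYPE('a) (Suc k))"
  define h where "h = Suc k div 2"
  have q: "2 \<le> q"
    using card_field_ge_2[where 'a = 'a] by (simp add: q_def)
  have b: "q ^ Suc k + 1 + int h - 2 * q ^ h \<le> int (Suc k) * b"
    unfolding q_def b_def h_def by (rule num_irr_ge) simp
  have "a \<le> b"
  proof (cases "k = 1")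
    case True
    have "a = q - 1"
      using True card_field_ge_2[where 'a = 'a] by (simp add: a_def num_irr_1[unfolded One_nat_def] q_def of_nat_diff)
    moreover have "0 \<le> (q - 2)\<^sup>2"
      by simp
    ultimately show ?thesis
      using b True by (simp add: h_def power2_eq_square algebra_simps)
  next
    case False
    with assms have "2 \<le> k" by simp
    have a: "int k * a \<le> q ^ k - q"
      unfolding q_def a_def by (rule num_irr_le[OF \<open>2 \<le> k\<close>])
    \<comment> \<open>This is what \<open>a \<le> b\<close> reduces to: \<open>k \<ge> 2\<close>
      gives \<open>2 * (k + 1) * a \<le> 3 * k * a \<le> 3 * (q ^ k - q)\<close>, while the lower
      bound for \<open>(k + 1) * b\<close> is weakened by
      \<open>q ^ Suc k \<ge> 2 * q ^ k\<close>.\<close>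
    have "4 * q ^ h \<le> q ^ k + 3 * q + 2 + 2 * int h"
    proof -
      consider "k = 2" | "k = 3" | "4 \<le> k"
        using \<open>2 \<le> k\<close> by linarith
      then show ?thesis
      proof cases
        case 1
        have "0 \<le> (q - 2)\<^sup>2"
          by simp
        with 1 q show ?thesis
          by (simp add: h_def power2_eq_square algebra_simps)
      next
        case 2
        \<comment> \<open>Since \<open>4 * q\<^sup>2 \<le> q ^ 3\<close> requires
          \<open>q \<ge> 4\<close>, the two smaller values are checked numerically.\<close>
        consider "q = 2" | "q = 3" | "4 \<le> q"
          using q by linarith
        then have "4 * q\<^sup>2 \<le> q ^ 3 + 3 * q + 6"
        proof cases
          case 3
          then have "4 * q\<^sup>2 \<le> q * q\<^sup>2"
            by (intro mult_right_mono) auto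
          moreover have "q ^ 3 = q * q\<^sup>2"
            by (simp add: power3_eq_cube power2_eq_square)
          ultimately show ?thesis using 3 by linarith
        qed auto
        with 2 show ?thesis by (simp add: h_def)
      next
        case 3
        then have "h + 2 \<le> k"
          by (simp add: h_def)
        then have "q ^ (h + 2) \<le> q ^ k"
          using q by (intro power_increasing) auto
        moreover have "4 * q ^ h \<le> q\<^sup>2 * q ^ h"
          using q power_mono[of 2 q 2] by (intro mult_right_mono) auto
        ultimately show ?thesis
          using q unfolding power_add mult.commute[of "q\<^sup>2"] by linarith
      qed
    qed
    moreover have "2 * q ^ k \<le> q ^ Suc k"
      using q by simp
    moreover have "4 * x \<le> y + 3 * q + 2 + 2 * z \<Longrightarrow> 2 * y \<le> w \<Longrightarrow> w + 1 + z - 2 * x \<le> c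
        \<Longrightarrow> 3 * y - 3 * q \<le> 2 * c" for x y z w c :: int
      by linarith
    ultimately have "3 * q ^ k - 3 * q \<le> 2 * (int (Suc k) * b)"
      using b by blast
    moreover have "2 * (int (Suc k) * a) \<le> 3 * (int k * a)"
      using \<open>2 \<le> k\<close> mult_right_mono[of 2 "int k" a] by (simp add: a_def algebra_simps)
    ultimately have "int (Suc k) * a \<le> int (Suc k) * b"
      using a by linarith
    then show ?thesis
      by simp
  qed
  then show ?thesis
    by (simp add: a_def b_def)
qed

lemma num_irr_mono:
  assumes "0 < k" "k \<le> m"
  shows "num_irr TYPE('a::{finite, field}) k \<le> num_irr TYPE('a) m"
  using assms(2)
proof (induction rule: dec_induct)
  case (step n)
  then show ?case
    using num_irr_Suc_mono[of n, where 'a = 'a] assms(1) by linarith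
qed simp

lemma num_irr_ge_half:
  assumes "4 \<le> m"
  shows "real CARD('a) ^ m / (2 * m) \<le> real (num_irr TYPE('a::{finite, field}) m)"
proof -
  define q where "q = int CARD('a)"
  have q: "2 \<le> q"
    using card_field_ge_2[where 'a = 'a] by (simp add: q_def)
  \<comment> \<open>The assumption \<open>m \<ge> 4\<close> gives
    \<open>m div 2 + 2 \<le> m\<close>; with \<open>q\<^sup>2 \<ge> 4\<close> the error term
    \<open>2 * q ^ (m div 2)\<close> is then at most half of \<open>q ^ m\<close>.\<close>
  have "q ^ (m div 2 + 2) \<le> q ^ m"
    using q assms by (intro power_increasing) auto
  moreover have "4 * q ^ (m div 2) \<le> q\<^sup>2 * q ^ (m div 2)"
    using q power_mono[of 2 q 2] by (intro mult_right_mono) auto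
  ultimately have "4 * q ^ (m div 2) \<le> q ^ m"
    unfolding power_add mult.commute[of "q\<^sup>2"] by linarith
  then have "q ^ m \<le> 2 * (int m * int (num_irr TYPE('a) m))"
    using num_irr_ge[of m, where 'a = 'a] assms unfolding q_def[symmetric] by linarith
  then have "real_of_int (q ^ m) \<le> real_of_int (2 * (int m * int (num_irr TYPE('a) m)))"
    by (simp only: of_int_le_iff)
  then show ?thesis
    using assms by (simp add: q_def field_simps)
qed

subsection \<open>Pairwise coprime sets of maximum size\<close>

text \<open>The index set of a maximum coprime set: every polynomial in \<open>monic_polys n\<close>
  has a divisor here, and no two coprime polynomials can share one.\<close>

definition base_irr :: "nat \<Rightarrow> 'a::{finite, field} poly set" where
  "base_irr n = irr_polys n \<union> (\<Union>k\<in>{1..n div 2}. irr_polys k)"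

text \<open>
  The assignments whose output lies in \<open>max_coprime_sets n\<close>: for \<open>2 * k = n\<close> only the identity does.
\<close>

definition proper_assignment :: "nat \<Rightarrow> (nat \<Rightarrow> 'a::{finite, field} poly \<Rightarrow> 'a poly) \<Rightarrow> bool" where
  "proper_assignment n \<phi> \<longleftrightarrow>
     valid_assignment n \<phi> \<and> (\<forall>k f. 2 * k = n \<longrightarrow> f \<in> irr_polys k \<longrightarrow> \<phi> k f = f)"

text \<open>Treating an irreducible of degree \<open>n\<close> as its own completion turns the
  construction into the image of \<open>base_irr n\<close> under one map, so that size and
  coprimality become properties of that map.\<close>

definition completion ::
    "nat \<Rightarrow> (nat \<Rightarrow> 'a::{finite, field} poly \<Rightarrow> 'a poly) \<Rightarrow> 'a poly \<Rightarrow> 'a poly" where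
  "completion n \<phi> f = f * (if degree f = n then 1 else \<phi> (degree f) f)"

lemma degree_irr_polys: "f \<in> irr_polys k \<Longrightarrow> degree f = k"
  by (simp add: irr_polys_def)

lemma base_irrE:
  assumes "f \<in> base_irr n"
  obtains "f \<in> irr_polys n" "degree f = n"
  | "f \<in> irr_polys (degree f)" "0 < degree f" "2 * degree f < n"
  | "f \<in> irr_polys (degree f)" "0 < degree f" "2 * degree f = n"
proof (cases "f \<in> irr_polys n")
  case True
  then show ?thesis
    using that(1) by (simp add: degree_irr_polys)
next
  case False
  then obtain k where k: "k \<in> {1..n div 2}" "f \<in> irr_polys k"
    using assms by (auto simp: base_irr_def)
  then have "f \<in> irr_polys (degree f)" "0 < degree f" "2 * degree f \<le> n"
    by (auto simp: degree_irr_polys)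
  then show ?thesis
    using that(2,3) by linarith
qed

lemma base_irr_imp_irr: "f \<in> base_irr n \<Longrightarrow> f \<in> irr_polys (degree f)"
  by (auto simp: base_irr_def degree_irr_polys)

lemma irr_in_base_irr: "f \<in> irr_polys k \<Longrightarrow> k \<le> n div 2 \<Longrightarrow> f \<in> base_irr n"
  using irr_polysD(3)[of f k] by (auto simp: base_irr_def Suc_le_eq)

lemma finite_base_irr [simp]: "finite (base_irr n)"
  by (simp add: base_irr_def)

lemma base_irr_divisor_exists:
  assumes "f \<in> monic_polys n" "0 < n"
  obtains p where "p \<in> base_irr n" "p dvd f"
proof (cases "f \<in> irr_polys n")
  case True
  then show ?thesis using that[of f] by (simp add: base_irr_def)
next
  case False
  then show ?thesis
    using small_irr_divisor_exists[OF assms] irr_in_base_irr that by metis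
qed

lemma irr_not_dvd_coprime:
  assumes "p \<in> irr_polys k" "p dvd f" "p dvd g"
  shows "\<not> coprime f g"
  using assms irr_polysD(1) not_coprimeI by (metis prime_elem_not_unit)

text \<open>A common divisor of positive degree inherits a nonzero constant term from
  \<open>f\<close>; after scaling it is monic and has an irreducible divisor of the required
  kind.\<close>

lemma common_irr_divisor:
  assumes "\<not> coprime f g" "f \<in> monic_polys n"
  obtains k p where "p \<in> irr_polys k" "p dvd f" "p dvd g"
proof -
  obtain d where d: "d dvd f" "d dvd g" "\<not> d dvd 1"
    using assms(1) by (auto elim: not_coprimeE)
  obtain u where u: "f = d * u"
    using d(1) ..
  have "d \<noteq> 0"
    using u monic_polys_nonzero[OF assms(2)] by auto
  then have "0 < degree d"
    using d(3) by (simp add: is_unit_iff_degree)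
  define c where "c = lead_coeff d"
  have "c \<noteq> 0"
    using \<open>d \<noteq> 0\<close> by (simp add: c_def)
  have "coeff d 0 \<noteq> 0"
    using assms(2) u by (auto simp: monic_polys_def coeff_mult_0)
  then have "smult (inverse c) d \<in> monic_polys (degree d)"
    using \<open>c \<noteq> 0\<close> by (simp add: monic_polys_def c_def)
  then obtain k p where p: "p \<in> irr_polys k" "p dvd smult (inverse c) d"
    using irr_divisor_exists \<open>0 < degree d\<close> by metis
  then have "p dvd d"
    using \<open>c \<noteq> 0\<close> by (simp add: dvd_smult_iff)
  with p d show ?thesis
    using that[of p k] dvd_trans by blast
qed

lemma irr_dvd_multD:
  assumes "p \<in> irr_polys k" "p dvd f * g" "f \<in> irr_polys i" "g \<in> irr_polys j"
  shows "p = f \<or> p = g"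
  using assms prime_elem_dvd_multD[OF irr_polysD(1)[OF assms(1)] assms(2)] irr_polys_dvd_eq by blast

lemma construct_eq_completion:
  assumes "0 < n"
  shows "construct n \<phi> = completion n \<phi> ` base_irr n"
proof -
  have "completion n \<phi> f = f" if "f \<in> irr_polys n" for f
    using that by (simp add: completion_def degree_irr_polys)
  moreover have "completion n \<phi> f = f * \<phi> k f" if "f \<in> irr_polys k" "k \<in> {1..n div 2}" for f k
    using that assms by (auto simp: completion_def degree_irr_polys)
  ultimately show ?thesis
    unfolding construct_def base_irr_def image_Un image_UN
    by (intro arg_cong2[of _ _ _ _ "(\<union>)"] SUP_cong refl) (auto intro: image_cong)
qed

lemma proper_assignmentD:
  assumes proper: "proper_assignment n \<phi>"
    and prems: "f \<in> irr_polys k" "0 < k" "2 * k \<le> n"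
  shows "\<phi> k f \<in> irr_polys (n - k)"
proof -
  have "k \<in> {1..n div 2}"
    using prems by auto
  then have "\<phi> k ` irr_polys k \<subseteq> irr_polys (n - k)"
    using proper by (simp add: proper_assignment_def valid_assignment_def)
  with prems(1) show ?thesis by blast
qed

lemma completion_in_monic_polys:
  assumes proper: "proper_assignment n \<phi>"
    and prems: "f \<in> base_irr n"
  shows "completion n \<phi> f \<in> monic_polys n"
  using prems
proof (cases rule: base_irrE)
  case 1
  then show ?thesis by (simp add: completion_def irr_polysD)
next
  case 2
  then show ?thesis
    using monic_polys_mult[OF irr_polysD(2) irr_polysD(2), OF _ proper_assignmentD[OF proper], of f "degree f" f "degree f"]
    by (auto simp: completion_def)
next
  case 3
  then show ?thesis
    using monic_polys_mult[OF irr_polysD(2) irr_polysD(2), OF _ proper_assignmentD[OF proper], of f "degree f" f "degree f"]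
    by (auto simp: completion_def)
qed

text \<open>In the middle degree the completion is \<open>f * f\<close>, so only
  \<open>p = f\<close> remains. The degree in the second alternative lies strictly between n / 2 and
  \<open>n\<close>, where \<open>base_irr n\<close> has no elements.\<close>

lemma irr_dvd_completion:
  assumes proper: "proper_assignment n \<phi>"
    and prems: "f \<in> base_irr n" "p \<in> irr_polys k" "p dvd completion n \<phi> f"
  shows "p = f \<or> (0 < degree f \<and> 2 * degree f < n \<and> p = \<phi> (degree f) f \<and> k = n - degree f)"
  using prems(1)
proof (cases rule: base_irrE)
  case 1
  then show ?thesis
    using prems irr_polys_dvd_eq by (auto simp: completion_def)
next
  case 2
  have *: "\<phi> (degree f) f \<in> irr_polys (n - degree f)"
    using 2 by (intro proper_assignmentD[OF proper]) auto
  have "completion n \<phi> f = f * \<phi> (degree f) f"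
    using 2 by (simp add: completion_def)
  then consider "p = f" | "p = \<phi> (degree f) f"
    using irr_dvd_multD[OF prems(2) _ 2(1) *] prems(3) by metis
  then show ?thesis
  proof cases
    case 2
    then have "k = n - degree f"
      using degree_irr_polys[OF prems(2)] degree_irr_polys[OF *] by simp
    with 2 \<open>0 < degree f\<close> \<open>2 * degree f < n\<close> show ?thesis by simp
  qed simp
next
  case 3
  then have "\<phi> (degree f) f = f"
    using proper by (simp add: proper_assignment_def)
  then have "completion n \<phi> f = f * f"
    using 3 by (simp add: completion_def)
  then show ?thesis
    using irr_dvd_multD[OF prems(2) _ 3(1) 3(1)] prems(3) by metis
qed

text \<open>The common factor cannot be a base irreducible on one side and an assigned factor on the
  other, by degrees. If it is assigned on both sides, the degrees of \<open>f\<close> and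
  \<open>g\<close> agree and injectivity of the assignment applies.\<close>

lemma completion_common_divisor:
  fixes \<phi> :: "nat \<Rightarrow> 'a::{finite, field} poly \<Rightarrow> 'a poly"
  assumes proper: "proper_assignment n \<phi>"
    and prems: "f \<in> base_irr n" "g \<in> base_irr n" "p \<in> irr_polys k"
      "p dvd completion n \<phi> f" "p dvd completion n \<phi> g"
  shows "f = g"
proof -
  have degrees: "\<not> (0 < degree r \<and> 2 * degree r < n \<and> degree s = n - degree r)"
    if "s \<in> base_irr n" for r s :: "'a poly"
    using that by (cases rule: base_irrE) auto
  have "f = g" if "2 * degree f < n" "0 < degree f" "degree f = degree g"
    "\<phi> (degree f) f = \<phi> (degree g) g"
  proof -
    have "degree f \<in> {1..n div 2}"
      using that by auto
    then have "inj_on (\<phi> (degree f)) (irr_polys (degree f))"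
      using proper by (simp add: proper_assignment_def valid_assignment_def)
    then show ?thesis
      using that base_irr_imp_irr[OF prems(1)] base_irr_imp_irr[OF prems(2)] by (auto dest: inj_onD)
  qed
  then show ?thesis
    using irr_dvd_completion[OF proper prems(1,3,4)] irr_dvd_completion[OF proper prems(2,3,5)]
      degrees[OF prems(1)] degrees[OF prems(2)] degree_irr_polys[OF prems(3)]
    by (metis diff_diff_cancel less_imp_le mult_2 trans_le_add1 add_leE)
qed

lemma inj_on_completion:
  assumes proper: "proper_assignment n \<phi>"
  shows "inj_on (completion n \<phi>) (base_irr n)"
proof (rule inj_onI)
  fix f g assume *: "f \<in> base_irr n" "g \<in> base_irr n" "completion n \<phi> f = completion n \<phi> g"
  have "f dvd completion n \<phi> f"
    by (simp add: completion_def)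
  with * show "f = g"
    using completion_common_divisor[OF proper *(1,2) base_irr_imp_irr[OF *(1)]] by simp
qed

lemma pairwise_coprime_completion:
  assumes proper: "proper_assignment n \<phi>"
  shows "pairwise coprime (completion n \<phi> ` base_irr n)"
proof (rule pairwiseI)
  fix a b assume "a \<in> completion n \<phi> ` base_irr n" "b \<in> completion n \<phi> ` base_irr n" "a \<noteq> b"
  then obtain f g where fg: "f \<in> base_irr n" "g \<in> base_irr n"
    "a = completion n \<phi> f" "b = completion n \<phi> g" "f \<noteq> g"
    by auto
  show "coprime a b"
  proof (rule ccontr)
    assume "\<not> coprime a b"
    moreover have "a \<in> monic_polys n"
      using completion_in_monic_polys[OF proper fg(1)] fg(3) by simp
    ultimately obtain k p where p: "p \<in> irr_polys k" "p dvd a" "p dvd b"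
      by (rule common_irr_divisor)
    then show False
      using completion_common_divisor[OF proper fg(1,2) p(1)] fg(3-5) by simp
  qed
qed

text \<open>A divisor chosen twice would contradict coprimality. The injection bounds the size of
  \<open>A\<close>; when \<open>A\<close> has maximum size it becomes a bijection onto
  \<open>base_irr n\<close>.\<close>

lemma base_irr_chooser:
  fixes A :: "'a::{finite, field} poly set"
  assumes "A \<subseteq> monic_polys n" "pairwise coprime A" "0 < n"
  obtains c where "\<And>a. a \<in> A \<Longrightarrow> c a \<in> base_irr n \<and> c a dvd a" "inj_on c A"
proof -
  have "\<forall>a\<in>A. \<exists>p. p \<in> base_irr n \<and> p dvd a"
    using assms base_irr_divisor_exists by (metis subsetD)
  then obtain c where c: "\<And>a. a \<in> A \<Longrightarrow> c a \<in> base_irr n \<and> c a dvd a"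
    by metis
  have "inj_on c A"
  proof (rule inj_onI, rule ccontr)
    fix a b assume "a \<in> A" "b \<in> A" "c a = c b" "a \<noteq> b"
    then have "coprime a b"
      using assms(2) by (simp add: pairwise_def)
    then show False
      using irr_not_dvd_coprime[OF base_irr_imp_irr, of "c a" n a b] c[of a] c[of b]
        \<open>a \<in> A\<close> \<open>b \<in> A\<close> \<open>c a = c b\<close> by auto
  qed
  with c show ?thesis using that by blast
qed

lemma card_pairwise_coprime_le:
  fixes A :: "'a::{finite, field} poly set"
  assumes "A \<subseteq> monic_polys n" "pairwise coprime A" "0 < n"
  shows "card A \<le> card (base_irr n :: 'a poly set)"
proof -
  obtain c where c: "\<And>a. a \<in> A \<Longrightarrow> c a \<in> base_irr n \<and> c a dvd a" "inj_on c A"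
    using base_irr_chooser[OF assms] by blast
  have "c ` A \<subseteq> base_irr n"
    using c(1) by auto
  then show ?thesis
    using card_inj_on_le[OF c(2)] by simp
qed

text \<open>Monotonicity of \<open>num_irr\<close> enters here: \<open>k \<le> n - k\<close> makes
  room for an injection.\<close>

lemma proper_assignment_exists: "\<exists>\<phi>. proper_assignment n (\<phi> :: nat \<Rightarrow> 'a::{finite, field} poly \<Rightarrow> 'a poly)"
proof -
  define P where "P k f \<longleftrightarrow> inj_on f (irr_polys k) \<and> f ` irr_polys k \<subseteq> (irr_polys (n - k) :: 'a poly set) \<and>
      (2 * k = n \<longrightarrow> (\<forall>x\<in>irr_polys k. f x = x))" for k f
  have "\<exists>f. P k f" if "k \<in> {1..n div 2}" for k
  proof (cases "2 * k = n")
    case True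
    then have "n - k = k" by simp
    then show ?thesis by (intro exI[of _ id]) (auto simp: P_def)
  next
    case False
    have "card (irr_polys k :: 'a poly set) \<le> card (irr_polys (n - k) :: 'a poly set)"
      using num_irr_mono[of k "n - k", where 'a = 'a] that by (auto simp: num_irr_def)
    then obtain f where "f ` (irr_polys k :: 'a poly set) \<subseteq> (irr_polys (n - k) :: 'a poly set)"
        "inj_on f (irr_polys k)"
      using card_le_inj[OF finite_irr_polys finite_irr_polys] by blast
    then have "P k f"
      using False by (simp add: P_def)
    then show ?thesis by (rule exI[of "P k" f])
  qed
  then obtain \<phi> where \<phi>: "\<forall>k\<in>{1..n div 2}. P k (\<phi> k)"
    using bchoice[of "{1..n div 2}" P] by metis
  have "proper_assignment n \<phi>"
    unfolding proper_assignment_def valid_assignment_def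
  proof (intro conjI ballI allI impI)
    fix k f assume *: "2 * k = n" "f \<in> (irr_polys k :: 'a poly set)"
    then have "k \<in> {1..n div 2}"
      using irr_polysD(3)[OF *(2)] by auto
    with * \<phi> show "\<phi> k f = f" unfolding P_def by blast
  qed (use \<phi> in \<open>simp_all add: P_def\<close>)
  then show ?thesis by (rule exI[of "proper_assignment n" \<phi>])
qed

lemma max_coprime_card_eq:
  assumes "0 < n"
  shows "max_coprime_card TYPE('a::{finite, field}) n = card (base_irr n :: 'a poly set)"
  unfolding max_coprime_card_def
proof (rule Max_eqI)
  have "{A :: 'a poly set. A \<subseteq> monic_polys n \<and> pairwise coprime A} \<subseteq> Pow (monic_polys n)"
    by auto
  then show "finite (card ` {A :: 'a poly set. A \<subseteq> monic_polys n \<and> pairwise coprime A})"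
    by (intro finite_imageI finite_subset[OF _ finite_Pow_iff[THEN iffD2, OF finite_monic_polys]])
next
  fix y assume "y \<in> card ` {A :: 'a poly set. A \<subseteq> monic_polys n \<and> pairwise coprime A}"
  then show "y \<le> card (base_irr n :: 'a poly set)"
    using card_pairwise_coprime_le assms by auto
next
  obtain \<phi> :: "nat \<Rightarrow> 'a poly \<Rightarrow> 'a poly" where \<phi>: "proper_assignment n \<phi>"
    using proper_assignment_exists by blast
  have "card (completion n \<phi> ` base_irr n) = card (base_irr n :: 'a poly set)"
    using inj_on_completion[OF \<phi>] by (rule card_image)
  moreover have "completion n \<phi> ` base_irr n \<subseteq> monic_polys n"
    using completion_in_monic_polys[OF \<phi>] by blast
  ultimately have mem: "completion n \<phi> ` base_irr n \<in> {A. A \<subseteq> monic_polys n \<and> pairwise coprime A}"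
    and card: "card (base_irr n :: 'a poly set) = card (completion n \<phi> ` base_irr n)"
    using pairwise_coprime_completion[OF \<phi>] by auto
  show "card (base_irr n :: 'a poly set) \<in> card ` {A :: 'a poly set. A \<subseteq> monic_polys n \<and> pairwise coprime A}"
    unfolding card by (rule imageI[OF mem])
qed

lemma construct_in_max_coprime_sets:
  assumes "proper_assignment n \<phi>" "0 < n"
  shows "construct n \<phi> \<in> max_coprime_sets n"
  using completion_in_monic_polys[OF assms(1)] pairwise_coprime_completion[OF assms(1)]
    card_image[OF inj_on_completion[OF assms(1)]]
  by (auto simp: max_coprime_sets_def max_coprime_card_eq[OF assms(2)] construct_eq_completion[OF assms(2)])

section \<open>Structure of a maximum set\<close>

lemma max_coprime_set_subset:
  assumes A: "A \<in> max_coprime_sets n"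
  shows "A \<subseteq> monic_polys n"
  using A by (simp add: max_coprime_sets_def)

lemma common_divisor_unique:
  assumes A: "A \<in> max_coprime_sets n"
    and prems: "a \<in> A" "b \<in> A" "p \<in> irr_polys k" "p dvd a" "p dvd b"
  shows "a = b"
  using irr_not_dvd_coprime[OF prems(3-5)] prems(1,2) A
  by (auto simp: max_coprime_sets_def pairwise_def)

lemma base_irr_chooser_surj:
  fixes A :: "'a::{finite, field} poly set"
  assumes A: "A \<in> max_coprime_sets n" and n: "0 < n"
  obtains c where "\<And>a. a \<in> A \<Longrightarrow> c a \<in> base_irr n \<and> c a dvd a" "c ` A = base_irr n"
proof -
  obtain c where c: "\<And>a. a \<in> A \<Longrightarrow> c a \<in> base_irr n \<and> c a dvd a" "inj_on c A"
    using base_irr_chooser[of A n] A n by (auto simp: max_coprime_sets_def)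
  have "card A = card (base_irr n :: 'a poly set)"
    using A by (simp add: max_coprime_sets_def max_coprime_card_eq[OF n])
  moreover have "c ` A \<subseteq> base_irr n"
    using c(1) by auto
  ultimately have "c ` A = base_irr n"
    using card_image[OF c(2)] by (intro card_subset_eq) auto
  with c(1) show ?thesis
    using that by blast
qed

lemma base_irr_multiple_exists:
  assumes A: "A \<in> max_coprime_sets n" and n: "0 < n" and p: "p \<in> base_irr n"
  shows "\<exists>a\<in>A. p dvd a"
proof -
  obtain c where c: "\<And>a. a \<in> A \<Longrightarrow> c a \<in> base_irr n \<and> c a dvd a" "c ` A = base_irr n"
    using base_irr_chooser_surj[OF A n] by blast
  with p show ?thesis
    by (metis imageE)
qed

text \<open>By surjectivity, a base divisor \<open>s\<close> of \<open>a\<close> is the chosen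
  divisor of some \<open>b\<close>. Then \<open>s\<close> divides both, hence \<open>a = b\<close>
  and \<open>s = c a\<close>.\<close>

lemma base_irr_divisor_unique:
  assumes A: "A \<in> max_coprime_sets n" and n: "0 < n" and a: "a \<in> A"
    and p: "p \<in> base_irr n" "p dvd a" and r: "r \<in> base_irr n" "r dvd a"
  shows "p = r"
proof -
  obtain c where c: "\<And>a. a \<in> A \<Longrightarrow> c a \<in> base_irr n \<and> c a dvd a" "c ` A = base_irr n"
    using base_irr_chooser_surj[OF A n] by blast
  have "c a = s" if s: "s \<in> base_irr n" "s dvd a" for s
  proof -
    obtain b where b: "b \<in> A" "c b = s"
      using s(1) c(2) by (metis imageE)
    then have "a = b"
      using common_divisor_unique[OF A a b(1) base_irr_imp_irr[OF s(1)] s(2)] c(1)[of b] by simp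
    with b show ?thesis by simp
  qed
  with p r show ?thesis by metis
qed

lemma max_set_full_degree:
  assumes A: "A \<in> max_coprime_sets n"
    and prems: "a \<in> A" "p \<in> irr_polys n" "p dvd a"
  shows "a = p"
  using monic_polys_dvd_same_degree[OF prems(3) irr_polysD(2)[OF prems(2)]] prems(1) max_coprime_set_subset[OF A]
  by auto

text \<open>The cofactor also has degree n / 2, so its irreducible divisors lie in
  \<open>base_irr n\<close> and must equal \<open>p\<close>. This is what leaves only the identity
  in the middle degree.\<close>

lemma max_set_half_degree:
  assumes A: "A \<in> max_coprime_sets n" and n: "0 < n"
    and prems: "p * g \<in> A" "p \<in> irr_polys k" "2 * k = n"
  shows "g = p"
proof -
  have g: "g \<in> monic_polys k"
    using monic_polys_cofactor(2)[of p g n k] prems irr_polysD(2)[OF prems(2)] max_coprime_set_subset[OF A] by auto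
  obtain d r where r: "d \<le> k" "r \<in> irr_polys d" "r dvd g"
    using irr_divisor_exists[OF g irr_polysD(3)[OF prems(2)]] by blast
  have "p = r"
    using base_irr_divisor_unique[OF A n prems(1), of p r] irr_in_base_irr[of r d n] irr_in_base_irr[of p k n] r prems by auto
  with r(3) show ?thesis
    using monic_polys_dvd_same_degree[OF _ irr_polysD(2)[OF prems(2)] g] by simp
qed

lemma max_set_large_degree:
  assumes A: "A \<in> max_coprime_sets n" and n: "0 < n"
    and prems: "p * g \<in> A" "p \<in> irr_polys k" "2 * k < n" "n < 3 * k"
  shows "g \<in> irr_polys (n - k)"
proof (rule ccontr)
  assume irr: "g \<notin> irr_polys (n - k)"
  have g: "g \<in> monic_polys (n - k)"
    using monic_polys_cofactor(2)[of p g n k] prems irr_polysD(2)[OF prems(2)] max_coprime_set_subset[OF A] by auto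
  have "0 < n - k"
    using prems(3) by simp
  obtain d r where r: "d \<le> (n - k) div 2" "r \<in> irr_polys d" "r dvd g"
    by (rule small_irr_divisor_exists[OF g \<open>0 < n - k\<close> irr])
  have "p = r"
    using base_irr_divisor_unique[OF A n prems(1), of p r] irr_in_base_irr[OF r(2), of n] irr_in_base_irr[OF prems(2), of n] r prems
    by simp
  \<comment> \<open>Impossible, since \<open>d \<le> (n - k) div 2 < k\<close> by
    \<open>n < 3 * k\<close>.\<close>
  then have "d = k"
    using r(2) prems(2) by (auto simp: degree_irr_polys dest: degree_irr_polys)
  with r(1) prems show False by simp
qed

subsection \<open>Counting the maximum sets\<close>

text \<open>Extensional functions, so that each injection between the two finite sets is counted
  once.\<close>

definition matchings :: "nat \<Rightarrow> nat \<Rightarrow> ('a::{finite, field} poly \<Rightarrow> 'a poly) set" where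
  "matchings n k = {f \<in> irr_polys k \<rightarrow>\<^sub>E irr_polys (n - k). inj_on f (irr_polys k)}"

lemma prod_falling_eq:
  assumes "k \<le> N"
  shows "(\<Prod>i=0..<k. N - i) = fact N div (fact (N - k) :: nat)"
proof -
  have "(\<Prod>i=0..<k. N - i) = (\<Prod>j=N - k + 1..N. j)"
    by (rule prod.reindex_bij_witness[of _ "\<lambda>j. N - j" "\<lambda>i. N - i"]) (use assms in auto)
  then show ?thesis
    by (simp add: fact_div_fact)
qed

lemma card_matchings:
  assumes "0 < k" "2 * k \<le> n"
  shows "card (matchings n k :: ('a::{finite, field} poly \<Rightarrow> 'a poly) set)
    = fact (num_irr TYPE('a) (n - k)) div fact (num_irr TYPE('a) (n - k) - num_irr TYPE('a) k)"
proof -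
  have le: "num_irr TYPE('a) k \<le> num_irr TYPE('a) (n - k)"
    using assms by (intro num_irr_mono) auto
  have "card (matchings n k :: ('a poly \<Rightarrow> 'a poly) set)
      = (\<Prod>i=0..<num_irr TYPE('a) k. num_irr TYPE('a) (n - k) - i)"
    unfolding matchings_def num_irr_def
    by (subst card_inj_on_subset_funcset) auto
  then show ?thesis
    by (simp only: prod_falling_eq[OF le])
qed

lemma finite_matchings [simp]: "finite (matchings n k)"
  unfolding matchings_def by (rule finite_subset[OF _ finite_PiE[of "irr_polys k" "\<lambda>_. irr_polys (n - k)"]]) auto

lemma card_matchings_pos:
  assumes "0 < k" "2 * k \<le> n"
  shows "1 \<le> card (matchings n k :: ('a::{finite, field} poly \<Rightarrow> 'a poly) set)"
  unfolding card_matchings[OF assms]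
  by (simp add: Suc_le_eq div_greater_zero_iff fact_mono_nat)

text \<open>The bound \<open>(n - 1) div 2\<close> used with it below is the largest
  \<open>k\<close> with \<open>2 * k < n\<close>, the range of free choices; the middle degree is
  filled with the forced identity.\<close>

definition extend_identity ::
    "nat \<Rightarrow> (nat \<Rightarrow> 'a::{finite, field} poly \<Rightarrow> 'a poly) \<Rightarrow> nat \<Rightarrow> 'a poly \<Rightarrow> 'a poly" where
  "extend_identity n \<Phi> k = (if 2 * k = n then id else \<Phi> k)"

lemma proper_extend_identity:
  assumes "\<Phi> \<in> (\<Pi>\<^sub>E k\<in>{1..(n - 1) div 2}. matchings n k)"
  shows "proper_assignment n (extend_identity n \<Phi>)"
proof -
  have "inj_on (extend_identity n \<Phi> k) (irr_polys k)
      \<and> extend_identity n \<Phi> k ` irr_polys k \<subseteq> irr_polys (n - k)" if k: "k \<in> {1..n div 2}" for k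
  proof (cases "2 * k = n")
    case True
    then have "n - k = k" by simp
    with True show ?thesis by (simp add: extend_identity_def)
  next
    case False
    with k have "k \<in> {1..(n - 1) div 2}" by auto
    with assms have "\<Phi> k \<in> matchings n k" by blast
    with False show ?thesis
      by (auto simp: extend_identity_def matchings_def)
  qed
  then show ?thesis
    by (simp add: proper_assignment_def valid_assignment_def extend_identity_def)
qed

lemma construct_cong:
  assumes "\<And>k f. k \<in> {1..n div 2} \<Longrightarrow> f \<in> irr_polys k \<Longrightarrow> \<phi> k f = \<psi> k f"
  shows "construct n \<phi> = construct n \<psi>"
  unfolding construct_def using assms
  by (intro arg_cong2[of _ _ _ _ "(\<union>)"] SUP_cong image_cong refl) auto

lemma mult_assignment_in_construct:
  assumes "f \<in> irr_polys k" "k \<in> {1..n div 2}"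
  shows "f * \<phi> k f \<in> construct n \<phi>"
  using assms by (auto simp: construct_def)

text \<open>Both products lie in one coprime set and share the factor \<open>f\<close>, hence they
  are equal and \<open>f\<close> cancels.\<close>

lemma construct_eqD:
  assumes "construct n \<phi> = construct n \<psi>" "construct n \<phi> \<in> max_coprime_sets n" "0 < n"
    and "f \<in> irr_polys k" "k \<in> {1..n div 2}"
  shows "\<phi> k f = \<psi> k f"
proof -
  have "f * \<phi> k f = f * \<psi> k f"
    using mult_assignment_in_construct[OF assms(4,5), of \<phi>] mult_assignment_in_construct[OF assms(4,5), of \<psi>]
    by (intro common_divisor_unique[OF assms(2) _ _ assms(4)]) (auto simp: assms(1))
  moreover have "f \<noteq> 0"
    using irr_polysD(2)[OF assms(4)] monic_polys_nonzero by blast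
  ultimately show ?thesis by simp
qed

lemma constructed_sets_eq:
  assumes "0 < n"
  shows "(constructed_sets n :: 'a::{finite, field} poly set set) =
    (\<lambda>\<Phi>. construct n (extend_identity n \<Phi>)) ` (\<Pi>\<^sub>E k\<in>{1..(n - 1) div 2}. matchings n k)"
proof (intro equalityI subsetI)
  fix A :: "'a poly set" assume A: "A \<in> constructed_sets n"
  then obtain \<phi> where \<phi>: "valid_assignment n \<phi>" "A = construct n \<phi>" and max: "A \<in> max_coprime_sets n"
    by (auto simp: constructed_sets_def)
  define \<Phi> where "\<Phi> = (\<lambda>k\<in>{1..(n - 1) div 2}. \<lambda>f\<in>irr_polys k. \<phi> k f)"
  have "\<Phi> \<in> (\<Pi>\<^sub>E k\<in>{1..(n - 1) div 2}. matchings n k)"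
  proof -
    have "(\<lambda>f\<in>irr_polys k. \<phi> k f) \<in> matchings n k" if "k \<in> {1..(n - 1) div 2}" for k
    proof -
      have "k \<in> {1..n div 2}"
        using that by auto
      then have "inj_on (\<phi> k) (irr_polys k)" "\<phi> k ` irr_polys k \<subseteq> irr_polys (n - k)"
        using \<phi>(1) by (auto simp: valid_assignment_def)
      then show ?thesis
        by (auto simp: matchings_def)
    qed
    then show ?thesis by (simp add: \<Phi>_def)
  qed
  moreover have "A = construct n (extend_identity n \<Phi>)"
    unfolding \<phi>(2)
  proof (rule construct_cong)
    fix k and f :: "'a poly" assume k: "k \<in> {1..n div 2}" and f: "f \<in> irr_polys k"
    show "\<phi> k f = extend_identity n \<Phi> k f"
    proof (cases "2 * k = n")
      case True
      \<comment> \<open>An arbitrary valid assignment need not be the identity here; maximality of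
        \<open>A\<close> forces it.\<close>
      have "f * \<phi> k f \<in> A"
        unfolding \<phi>(2) by (rule mult_assignment_in_construct[OF f k])
      with True show ?thesis
        using max_set_half_degree[OF max assms _ f True] by (simp add: extend_identity_def)
    next
      case False
      with k have "k \<in> {1..(n - 1) div 2}" by auto
      with False f show ?thesis
        by (simp add: extend_identity_def \<Phi>_def)
    qed
  qed
  ultimately show "A \<in> (\<lambda>\<Phi>. construct n (extend_identity n \<Phi>)) ` (\<Pi>\<^sub>E k\<in>{1..(n - 1) div 2}. matchings n k)"
    by blast
next
  fix A :: "'a poly set"
  assume "A \<in> (\<lambda>\<Phi>. construct n (extend_identity n \<Phi>)) ` (\<Pi>\<^sub>E k\<in>{1..(n - 1) div 2}. matchings n k)"
  then obtain \<Phi> :: "nat \<Rightarrow> 'a poly \<Rightarrow> 'a poly" where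
    "A = construct n (extend_identity n \<Phi>)" "proper_assignment n (extend_identity n \<Phi>)"
    using proper_extend_identity by auto
  then show "A \<in> constructed_sets n"
    using construct_in_max_coprime_sets[OF _ assms]
    by (auto simp: constructed_sets_def proper_assignment_def)
qed

lemma inj_on_construct:
  assumes "0 < n"
  shows "inj_on (\<lambda>\<Phi>. construct n (extend_identity n \<Phi>)) (\<Pi>\<^sub>E k\<in>{1..(n - 1) div 2}. matchings n k)"
proof (rule inj_onI)
  fix \<Phi> \<Psi> :: "nat \<Rightarrow> 'a poly \<Rightarrow> 'a poly"
  assume \<Phi>: "\<Phi> \<in> (\<Pi>\<^sub>E k\<in>{1..(n - 1) div 2}. matchings n k)"
    and \<Psi>: "\<Psi> \<in> (\<Pi>\<^sub>E k\<in>{1..(n - 1) div 2}. matchings n k)"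
    and eq: "construct n (extend_identity n \<Phi>) = construct n (extend_identity n \<Psi>)"
  show "\<Phi> = \<Psi>"
  proof (rule PiE_ext[OF \<Phi> \<Psi>])
    fix k assume k: "k \<in> {1..(n - 1) div 2}"
    then have k': "k \<in> {1..n div 2}" "2 * k \<noteq> n"
      by auto
    have mem: "\<Phi> k \<in> irr_polys k \<rightarrow>\<^sub>E irr_polys (n - k)" "\<Psi> k \<in> irr_polys k \<rightarrow>\<^sub>E irr_polys (n - k)"
      using PiE_mem[OF \<Phi> k] PiE_mem[OF \<Psi> k] by (auto simp: matchings_def)
    show "\<Phi> k = \<Psi> k"
    proof (rule PiE_ext[OF mem])
      fix f :: "'a poly" assume "f \<in> irr_polys k"
      then have "extend_identity n \<Phi> k f = extend_identity n \<Psi> k f"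
        using construct_eqD[OF eq construct_in_max_coprime_sets[OF proper_extend_identity[OF \<Phi>] assms] assms] k'(1)
        by blast
      with k'(2) show "\<Phi> k f = \<Psi> k f"
        by (simp add: extend_identity_def)
    qed
  qed
qed

theorem num_constructed_sets_eq_prod:
  assumes "0 < n"
  shows "num_constructed_sets TYPE('a::{finite, field}) n
    = (\<Prod>k=1..(n - 1) div 2. card (matchings n k :: ('a poly \<Rightarrow> 'a poly) set))"
  unfolding num_constructed_sets_def constructed_sets_eq[OF assms] card_image[OF inj_on_construct[OF assms]]
  by (simp add: card_PiE)

lemma num_constructed_sets_pos:
  assumes "0 < n"
  shows "1 \<le> num_constructed_sets TYPE('a::{finite, field}) n"
  unfolding num_constructed_sets_eq_prod[OF assms]
  by (rule prod_ge_1) (auto intro!: card_matchings_pos[unfolded One_nat_def])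

lemma prod_card_matchings_le:
  assumes "K \<subseteq> {1..(n - 1) div 2}" "0 < n"
  shows "(\<Prod>k\<in>K. card (matchings n k :: ('a poly \<Rightarrow> 'a poly) set))
    \<le> num_constructed_sets TYPE('a::{finite, field}) n"
proof (rule dvd_imp_le)
  show "(\<Prod>k\<in>K. card (matchings n k :: ('a poly \<Rightarrow> 'a poly) set)) dvd num_constructed_sets TYPE('a) n"
    unfolding num_constructed_sets_eq_prod[OF assms(2)] using assms(1) by (intro prod_dvd_prod_subset) auto
  show "0 < num_constructed_sets TYPE('a) n"
    using num_constructed_sets_pos[OF assms(2), where 'a = 'a] by linarith
qed

lemma num_constructed_sets_formula:
  assumes "0 < n"
  shows "real (num_constructed_sets TYPE('a::{finite, field}) n) =
    (\<Prod>k=1..(n - 1) div 2. fact (num_irr TYPE('a) (n - k)) /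
      fact (num_irr TYPE('a) (n - k) - num_irr TYPE('a) k))"
  unfolding num_constructed_sets_eq_prod[OF assms] of_nat_prod
proof (intro prod.cong refl)
  fix k assume "k \<in> {1..(n - 1) div 2}"
  then have "0 < k" "2 * k \<le> n" by auto
  then show "real (card (matchings n k :: ('a poly \<Rightarrow> 'a poly) set)) =
      fact (num_irr TYPE('a) (n - k)) / fact (num_irr TYPE('a) (n - k) - num_irr TYPE('a) k)"
    by (simp only: card_matchings real_of_nat_div[OF fact_dvd[OF diff_le_self]] of_nat_fact)
qed

section \<open>Encoding a maximum set by its base irreducibles\<close>

definition multiple_of :: "'a::{finite, field} poly set \<Rightarrow> 'a poly \<Rightarrow> 'a poly" where
  "multiple_of A p = (THE a. a \<in> A \<and> p dvd a)"

lemma multiple_of: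
  assumes "A \<in> max_coprime_sets n" "0 < n" "p \<in> base_irr n"
  shows "multiple_of A p \<in> A" "p dvd multiple_of A p"
proof -
  have "\<exists>!a. a \<in> A \<and> p dvd a"
    using base_irr_multiple_exists[OF assms] common_divisor_unique[OF assms(1) _ _ base_irr_imp_irr[OF assms(3)]]
    by blast
  from theI'[OF this] show "multiple_of A p \<in> A" "p dvd multiple_of A p"
    by (simp_all add: multiple_of_def)
qed

lemma max_coprime_set_eq_image:
  assumes "A \<in> max_coprime_sets n" "0 < n"
  shows "A = multiple_of A ` base_irr n"
proof (intro equalityI subsetI)
  fix a assume a: "a \<in> A"
  then have "a \<in> monic_polys n"
    using max_coprime_set_subset[OF assms(1)] by auto
  then obtain p where p: "p \<in> base_irr n" "p dvd a"
    using base_irr_divisor_exists assms(2) by blast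
  then have "a = multiple_of A p"
    using multiple_of[OF assms p(1)] common_divisor_unique[OF assms(1) a _ base_irr_imp_irr[OF p(1)]] by blast
  with p(1) show "a \<in> multiple_of A ` base_irr n" by blast
qed (use multiple_of[OF assms] in auto)

lemma inj_on_multiple_of:
  assumes "A \<in> max_coprime_sets n" "0 < n"
  shows "inj_on (multiple_of A) (base_irr n)"
proof (rule inj_onI)
  fix p r assume "p \<in> base_irr n" "r \<in> base_irr n" "multiple_of A p = multiple_of A r"
  then show "p = r"
    using base_irr_divisor_unique[OF assms, of "multiple_of A p" p r] multiple_of[OF assms] by metis
qed

text \<open>Equal cofactors would be a common irreducible factor of degree \<open>n - k\<close>, so
  the two elements coincide, and an element has only one base divisor.\<close>

lemma max_coprime_set_matching:
  assumes "A \<in> max_coprime_sets n" "0 < n" "2 * k < n" "n < 3 * k"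
  shows "(\<lambda>p\<in>irr_polys k. multiple_of A p div p) \<in> matchings n k"
proof -
  have k: "k \<le> n div 2"
    using assms(3) by linarith
  have cofactor: "multiple_of A p = p * (multiple_of A p div p)" if "p \<in> irr_polys k" for p
    using multiple_of(2)[OF assms(1,2) irr_in_base_irr[OF that k]] by simp
  have mem: "multiple_of A p div p \<in> irr_polys (n - k)" if "p \<in> irr_polys k" for p
    using max_set_large_degree[OF assms(1,2) _ that assms(3,4), of "multiple_of A p div p"]
      multiple_of(1)[OF assms(1,2) irr_in_base_irr[OF that k]] cofactor[OF that] by simp
  have "inj_on (\<lambda>p. multiple_of A p div p) (irr_polys k)"
  proof (rule inj_onI)
    fix p r assume pr: "p \<in> irr_polys k" "r \<in> irr_polys k"
      and eq: "multiple_of A p div p = multiple_of A r div r"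
    have "multiple_of A p div p dvd multiple_of A p"
      using cofactor[OF pr(1)] by (metis dvd_triv_right)
    moreover have "multiple_of A p div p dvd multiple_of A r"
      using cofactor[OF pr(2)] eq by (metis dvd_triv_right)
    ultimately have "multiple_of A p = multiple_of A r"
      using common_divisor_unique[OF assms(1) _ _ mem[OF pr(1)]]
        multiple_of(1)[OF assms(1,2) irr_in_base_irr[OF _ k]] pr by blast
    then show "p = r"
      using inj_onD[OF inj_on_multiple_of[OF assms(1,2)]] irr_in_base_irr[OF _ k] pr by blast
  qed
  with mem show ?thesis
    by (auto simp: matchings_def)
qed

text \<open>
  A maximum set is determined by the element containing each irreducible \<open>p\<close> of degree at most
  \<open>n div 2\<close>. For \<open>n / 3 < deg p < n / 2\<close> this element is \<open>p\<close> times another irreducible polynomial, so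
  that the construction already accounts for it; for \<open>deg p \<le> n / 3\<close> the crude bound by
  all of \<open>monic_polys n\<close> suffices.
\<close>

theorem num_max_coprime_sets_le:
  assumes "0 < n"
  shows "num_max_coprime_sets TYPE('a::{finite, field}) n
    \<le> card (monic_polys n :: 'a poly set) ^ (\<Sum>k=1..n div 3. num_irr TYPE('a) k)
      * num_constructed_sets TYPE('a) n"
proof -
  define L where "L = (\<Union>k\<in>{1..n div 3}. irr_polys k :: 'a poly set)"
  define K where "K = {k. 2 * k < n \<and> n < 3 * k}"
  \<comment> \<open>The code of \<open>A\<close> keeps whole elements for \<open>p\<close> of degree
    at most n / 3 and only cofactors for degrees in \<open>K\<close>. Degrees \<open>n\<close> and n
    / 2 are omitted: there the element must be \<open>p\<close> or \<open>p * p\<close>.\<close>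
  define R where "R = (\<lambda>A :: 'a poly set. (\<lambda>p\<in>L. multiple_of A p,
      \<lambda>k\<in>K. \<lambda>p\<in>irr_polys k. multiple_of A p div p))"
  have "finite L"
    by (simp add: L_def)
  have K: "K \<subseteq> {1..(n - 1) div 2}"
    by (auto simp: K_def)
  then have "finite K"
    by (rule finite_subset) simp
  have L_base: "p \<in> base_irr n" if "p \<in> L" for p
    using that irr_in_base_irr[of p _ n] by (fastforce simp: L_def)
  have inj: "inj_on R (max_coprime_sets n)"
  proof (rule inj_onI)
    fix A B :: "'a poly set"
    assume A: "A \<in> max_coprime_sets n" and B: "B \<in> max_coprime_sets n" and eq: "R A = R B"
    have "multiple_of A p = multiple_of B p" if p: "p \<in> base_irr n" for p
    proof -
      note mA = multiple_of[OF A assms p] and mB = multiple_of[OF B assms p]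
      from p show ?thesis
      proof (cases rule: base_irrE)
        case 1
        then show ?thesis
          using max_set_full_degree[OF A mA(1) _ mA(2)] max_set_full_degree[OF B mB(1) _ mB(2)]
          by simp
      next
        case 2
        show ?thesis
        proof (cases "3 * degree p \<le> n")
          case True
          then have "degree p \<in> {1..n div 3}"
            using 2(2) by auto
          with 2(1) have "p \<in> L"
            unfolding L_def by blast
          moreover have "(\<lambda>p\<in>L. multiple_of A p) p = (\<lambda>p\<in>L. multiple_of B p) p"
            using eq by (simp add: R_def)
          ultimately show ?thesis by simp
        next
          case False
          with 2 have "degree p \<in> K"
            by (simp add: K_def)
          moreover have "(\<lambda>k\<in>K. \<lambda>p\<in>irr_polys k. multiple_of A p div p) (degree p) p
              = (\<lambda>k\<in>K. \<lambda>p\<in>irr_polys k. multiple_of B p div p) (degree p) p"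
            using eq by (simp add: R_def)
          ultimately have "multiple_of A p div p = multiple_of B p div p"
            using 2(1) by simp
          then show ?thesis
            using mA(2) mB(2) by (metis dvd_mult_div_cancel)
        qed
      next
        case 3
        obtain g h where "multiple_of A p = p * g" "multiple_of B p = p * h"
          using mA(2) mB(2) by (auto elim!: dvdE)
        then show ?thesis
          using max_set_half_degree[OF A assms _ 3(1,3), of g] max_set_half_degree[OF B assms _ 3(1,3), of h] mA(1) mB(1)
          by simp
      qed
    qed
    then show "A = B"
      using max_coprime_set_eq_image[OF A assms] max_coprime_set_eq_image[OF B assms]
      by (metis image_cong)
  qed
  have "R ` max_coprime_sets n \<subseteq> (L \<rightarrow>\<^sub>E monic_polys n) \<times> (\<Pi>\<^sub>E k\<in>K. matchings n k)"
  proof (rule image_subsetI)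
    fix A :: "'a poly set" assume A: "A \<in> max_coprime_sets n"
    have "multiple_of A p \<in> monic_polys n" if "p \<in> L" for p
      using multiple_of(1)[OF A assms L_base[OF that]] max_coprime_set_subset[OF A] by auto
    moreover have "(\<lambda>p\<in>irr_polys k. multiple_of A p div p) \<in> matchings n k" if "k \<in> K" for k
      using max_coprime_set_matching[OF A assms] that by (simp add: K_def)
    ultimately show "R A \<in> (L \<rightarrow>\<^sub>E monic_polys n) \<times> (\<Pi>\<^sub>E k\<in>K. matchings n k)"
      by (auto simp: R_def)
  qed
  then have "card (max_coprime_sets n :: 'a poly set set)
      \<le> card ((L \<rightarrow>\<^sub>E (monic_polys n :: 'a poly set)) \<times> (\<Pi>\<^sub>E k\<in>K. matchings n k :: ('a poly \<Rightarrow> 'a poly) set))"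
    using \<open>finite L\<close> \<open>finite K\<close> by (intro card_inj_on_le[OF inj]) (auto intro!: finite_PiE)
  also have "\<dots> = card (monic_polys n :: 'a poly set) ^ card L
      * (\<Prod>k\<in>K. card (matchings n k :: ('a poly \<Rightarrow> 'a poly) set))"
    using \<open>finite L\<close> \<open>finite K\<close> by (simp add: card_cartesian_product card_PiE)
  also have "\<dots> \<le> card (monic_polys n :: 'a poly set) ^ (\<Sum>k=1..n div 3. num_irr TYPE('a) k)
      * num_constructed_sets TYPE('a) n"
  proof (rule mult_mono)
    have "card L \<le> (\<Sum>k=1..n div 3. num_irr TYPE('a) k)"
      unfolding L_def num_irr_def by (rule card_UN_le) simp
    moreover have "1 \<le> card (monic_polys n :: 'a poly set)"
    proof -
      obtain m where "n = Suc m"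
        using assms by (cases n) auto
      then show ?thesis
        using card_field_ge_2[where 'a = 'a] by (simp add: card_monic_polys_Suc Suc_le_eq)
    qed
    ultimately show "card (monic_polys n :: 'a poly set) ^ card L
        \<le> card (monic_polys n :: 'a poly set) ^ (\<Sum>k=1..n div 3. num_irr TYPE('a) k)"
      by (rule power_increasing)
    \<comment> \<open>\<open>K\<close> yields only some of the factors of
      \<open>num_constructed_sets\<close>; the others are at least 1.\<close>
    show "(\<Prod>k\<in>K. card (matchings n k :: ('a poly \<Rightarrow> 'a poly) set)) \<le> num_constructed_sets TYPE('a) n"
      by (rule prod_card_matchings_le[OF K assms])
  qed auto
  finally show ?thesis
    by (simp add: num_max_coprime_sets_def)
qed

lemma num_constructed_sets_le_num_max:
  "num_constructed_sets TYPE('a::{finite, field}) n \<le> num_max_coprime_sets TYPE('a) n"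
  unfolding num_constructed_sets_def num_max_coprime_sets_def
proof (rule card_mono)
  have "(max_coprime_sets n :: 'a poly set set) \<subseteq> Pow (monic_polys n)"
    by (auto simp: max_coprime_sets_def)
  then show "finite (max_coprime_sets n :: 'a poly set set)"
    by (rule finite_subset) simp
qed (auto simp: constructed_sets_def)

subsection \<open>Asymptotics\<close>

text \<open>The last terms dominate, and there 1 / k is about 1 / m. The constant
  \<open>C = 4\<close> is the least that passes the induction step at \<open>Q = 2\<close>: from
  \<open>S \<le> m * S / 2\<close> one needs \<open>3 / 2 * C + 2 \<le> 2 * C\<close>.\<close>

lemma weighted_geometric_sum_le:
  fixes Q :: real
  assumes "2 \<le> Q"
  shows "real m * (\<Sum>k=1..m. Q ^ k / k) \<le> 4 * Q ^ m"
proof (cases "m \<le> 1")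
  case True
  then have "m = 0 \<or> m = 1" by auto
  then show ?thesis using assms by auto
next
  case False
  then have "2 \<le> m" by simp
  then show ?thesis
  proof (induction m rule: dec_induct)
    case base
    have "2 * Q \<le> Q * Q"
      using assms by (intro mult_right_mono) auto
    moreover have "{1..2} = {1, 2 :: nat}" by auto
    ultimately show ?case
      using assms by (simp add: power2_eq_square field_simps)
  next
    case (step m)
    define S where "S = (\<Sum>k=1..m. Q ^ k / k)"
    have "0 \<le> S"
      using assms by (auto simp: S_def intro!: sum_nonneg)
    then have "2 * S \<le> real m * S"
      using step by (intro mult_right_mono) auto
    moreover have "real (Suc m) * (\<Sum>k=1..Suc m. Q ^ k / k) = real m * S + S + Q ^ Suc m"
      by (simp add: S_def field_simps)
    moreover have "2 * Q ^ m \<le> Q ^ Suc m"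
      using assms by simp
    ultimately show ?case
      using step.IH unfolding S_def[symmetric] by linarith
  qed
qed

lemma num_irr_real_le:
  assumes "0 < k"
  shows "real (num_irr TYPE('a::{finite, field}) k) \<le> real CARD('a) ^ k / k"
proof -
  have "real (k * num_irr TYPE('a) k) \<le> real (CARD('a) ^ k)"
    using num_irr_le_power[OF assms, where 'a = 'a] by (simp only: of_nat_le_iff)
  then show ?thesis
    using assms by (simp add: field_simps)
qed

text \<open>The constant \<open>c\<close> trades the factor \<open>n\<close>, which arises as the
  logarithm of \<open>q ^ n\<close>, for the upper summation limit \<open>m\<close>, which the
  weighted sum absorbs.\<close>

lemma sum_num_irr_le:
  fixes c m n :: nat
  assumes "n \<le> c * m"
  shows "real n * (\<Sum>k=1..m. real (num_irr TYPE('a::{finite, field}) k)) \<le> 4 * real c * real CARD('a) ^ m"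
proof -
  let ?Q = "real CARD('a)"
  have Q: "2 \<le> ?Q"
    using card_field_ge_2[where 'a = 'a] by simp
  have "real n * (\<Sum>k=1..m. real (num_irr TYPE('a) k)) \<le> real (c * m) * (\<Sum>k=1..m. ?Q ^ k / k)"
    using assms by (intro mult_mono sum_mono sum_nonneg num_irr_real_le) (auto simp flip: of_nat_mult)
  also have "\<dots> = real c * (real m * (\<Sum>k=1..m. ?Q ^ k / k))"
    by simp
  also have "\<dots> \<le> real c * (4 * ?Q ^ m)"
    by (intro mult_left_mono weighted_geometric_sum_le Q) simp
  finally show ?thesis by simp
qed

text \<open>One term of the exponential series at \<open>n\<close>; this weak form of Stirling's
  bound suffices.\<close>

lemma power_self_le_exp_fact: "real n ^ n \<le> exp (real n) * fact n"
proof -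
  have "(\<Sum>k\<in>{n}. real n ^ k /\<^sub>R fact k) \<le> (\<Sum>k. real n ^ k /\<^sub>R fact k)"
    by (intro sum_le_suminf summable_exp_generic) auto
  then show ?thesis
    by (simp add: exp_def field_simps)
qed

lemma num_irr_le_card_power:
  "num_irr TYPE('a::{finite, field}) k \<le> CARD('a) ^ k"
proof (cases "k = 0")
  case True
  have "irr_polys 0 = ({} :: 'a poly set)"
    using irr_polysD(3)[of _ 0] by auto
  with True show ?thesis by (simp add: num_irr_def)
next
  case False
  then have "num_irr TYPE('a) k \<le> k * num_irr TYPE('a) k" by simp
  also have "\<dots> \<le> CARD('a) ^ k"
    using False by (intro num_irr_le_power) simp
  finally show ?thesis .
qed

lemma card_matchings_le:
  "card (matchings n k :: ('a::{finite, field} poly \<Rightarrow> 'a poly) set) \<le> (CARD('a) ^ n) ^ num_irr TYPE('a) k"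
proof -
  have "card (matchings n k :: ('a poly \<Rightarrow> 'a poly) set)
      \<le> card (irr_polys k \<rightarrow>\<^sub>E (irr_polys (n - k) :: 'a poly set) :: ('a poly \<Rightarrow> 'a poly) set)"
    by (intro card_mono finite_PiE) (auto simp: matchings_def)
  also have "\<dots> = num_irr TYPE('a) (n - k) ^ num_irr TYPE('a) k"
    by (simp add: card_funcsetE num_irr_def)
  also have "\<dots> \<le> (CARD('a) ^ n) ^ num_irr TYPE('a) k"
  proof (rule power_mono)
    have "num_irr TYPE('a) (n - k) \<le> CARD('a) ^ (n - k)"
      by (rule num_irr_le_card_power)
    also have "\<dots> \<le> CARD('a) ^ n"
      using card_field_ge_2[where 'a = 'a] by (intro power_increasing) auto
    finally show "num_irr TYPE('a) (n - k) \<le> CARD('a) ^ n" .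
  qed simp
  finally show ?thesis .
qed

lemma card_monic_polys_le:
  "card (monic_polys n :: 'a::{finite, field} poly set) \<le> CARD('a) ^ n"
proof -
  have "card (monic_polys n :: 'a poly set) \<le> card {f :: 'a poly. lead_coeff f = 1 \<and> degree f = n}"
    by (intro card_mono conjunct2[OF card_monic_degree]) (auto simp: monic_polys_def)
  also have "\<dots> = CARD('a) ^ n"
    by (rule conjunct1[OF card_monic_degree])
  finally show ?thesis .
qed

text \<open>The quotient of factorials is \<open>fact ?i\<close> times the binomial coefficient
  \<open>?j choose ?i\<close>.\<close>

lemma fact_le_card_matchings:
  assumes "0 < k" "2 * k \<le> n"
  shows "fact (num_irr TYPE('a) k) \<le> card (matchings n k :: ('a::{finite, field} poly \<Rightarrow> 'a poly) set)"
proof -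
  let ?i = "num_irr TYPE('a) k" and ?j = "num_irr TYPE('a) (n - k)"
  have "?i \<le> ?j"
    using assms by (intro num_irr_mono) auto
  then have "fact ?i * fact (?j - ?i) dvd (fact ?j :: nat)"
    using fact_fact_dvd_fact[of ?i "?j - ?i"] by simp
  then have "fact ?i * fact (?j - ?i) \<le> (fact ?j :: nat)"
    by (intro dvd_imp_le) auto
  then show ?thesis
    unfolding card_matchings[OF assms] by (simp add: less_eq_div_iff_mult_less_eq)
qed

lemma num_constructed_sets_upper:
  assumes "0 < n"
  shows "num_constructed_sets TYPE('a::{finite, field}) n
    \<le> (CARD('a) ^ n) ^ (\<Sum>k=1..(n - 1) div 2. num_irr TYPE('a) k)"
  unfolding num_constructed_sets_eq_prod[OF assms] power_sum
  by (intro prod_mono conjI card_matchings_le) simp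

lemma num_constructed_sets_lower:
  assumes "3 \<le> n"
  shows "fact (num_irr TYPE('a) ((n - 1) div 2)) \<le> num_constructed_sets TYPE('a::{finite, field}) n"
proof -
  let ?m = "(n - 1) div 2"
  have "fact (num_irr TYPE('a) ?m) \<le> (\<Prod>k\<in>{?m}. card (matchings n k :: ('a poly \<Rightarrow> 'a poly) set))"
    using assms by (simp add: fact_le_card_matchings)
  also have "\<dots> \<le> num_constructed_sets TYPE('a) n"
    using assms by (intro prod_card_matchings_le) auto
  finally show ?thesis .
qed

lemma log_num_constructed_sets_le:
  assumes "3 \<le> n"
  shows "log CARD('a) (num_constructed_sets TYPE('a::{finite, field}) n) \<le> 16 * real CARD('a) ^ ((n - 1) div 2)"
proof -
  let ?Q = "real CARD('a)" and ?m = "(n - 1) div 2"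
  define s where "s = (\<Sum>k=1..?m. num_irr TYPE('a) k)"
  have Q: "2 \<le> ?Q"
    using card_field_ge_2[where 'a = 'a] by simp
  have "real (num_constructed_sets TYPE('a) n) \<le> real ((CARD('a) ^ n) ^ s)"
    unfolding of_nat_le_iff s_def using assms by (intro num_constructed_sets_upper) simp
  moreover have "0 < real (num_constructed_sets TYPE('a) n)"
    using num_constructed_sets_pos[of n, where 'a = 'a] assms by simp
  ultimately have "log ?Q (num_constructed_sets TYPE('a) n) \<le> log ?Q (?Q ^ (n * s))"
    using Q by (simp add: power_mult)
  also have "\<dots> = real n * (\<Sum>k=1..?m. real (num_irr TYPE('a) k))"
    using Q by (simp add: log_nat_power s_def)
  \<comment> \<open>The second 4 is needed at \<open>n = 4\<close>, where
    \<open>(n - 1) div 2 = 1\<close>.\<close>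
  also have "\<dots> \<le> 4 * real 4 * ?Q ^ ?m"
  proof (rule sum_num_irr_le)
    have "1 \<le> ?m"
      using assms by simp
    then show "n \<le> 4 * ?m"
      by linarith
  qed
  finally show ?thesis by simp
qed

lemma log_num_max_coprime_sets_diff_le:
  assumes "3 \<le> n"
  shows "log CARD('a) (num_max_coprime_sets TYPE('a::{finite, field}) n)
    - log CARD('a) (num_constructed_sets TYPE('a) n) \<le> 20 * real CARD('a) ^ (n div 3)"
proof -
  let ?Q = "real CARD('a)" and ?D = "num_constructed_sets TYPE('a) n" and ?T = "num_max_coprime_sets TYPE('a) n"
  define s where "s = (\<Sum>k=1..n div 3. num_irr TYPE('a) k)"
  have Q: "2 \<le> ?Q"
    using card_field_ge_2[where 'a = 'a] by simp
  have "?T \<le> card (monic_polys n :: 'a poly set) ^ s * ?D"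
    unfolding s_def using assms by (intro num_max_coprime_sets_le) simp
  also have "\<dots> \<le> (CARD('a) ^ n) ^ s * ?D"
    by (intro mult_right_mono power_mono card_monic_polys_le) auto
  finally have "real ?T \<le> real ((CARD('a) ^ n) ^ s * ?D)"
    by (simp only: of_nat_le_iff)
  then have le: "real ?T \<le> ?Q ^ (n * s) * real ?D"
    by (simp add: power_mult)
  have D: "0 < ?D" and T: "0 < ?T"
    using num_constructed_sets_pos[of n, where 'a = 'a] num_constructed_sets_le_num_max[of n, where 'a = 'a] assms
    by linarith+
  have "log ?Q ?T \<le> log ?Q (?Q ^ (n * s) * real ?D)"
    using Q T le D by (subst log_le_cancel_iff) auto
  also have "\<dots> = real (n * s) + log ?Q ?D"
    using Q D by (simp add: log_mult log_nat_power)
  finally have "log ?Q ?T - log ?Q ?D \<le> real n * (\<Sum>k=1..n div 3. real (num_irr TYPE('a) k))"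
    by (simp add: s_def)
  \<comment> \<open>The 5 is needed at \<open>n = 5\<close>, where
    \<open>n div 3 = 1\<close>.\<close>
  also have "\<dots> \<le> 4 * real 5 * ?Q ^ (n div 3)"
  proof (rule sum_num_irr_le)
    have "1 \<le> n div 3"
      using assms by simp
    then show "n \<le> 5 * (n div 3)"
      by linarith
  qed
  finally show ?thesis by simp
qed

lemma ln_fact_ge: "real n * (ln (real n) - 1) \<le> ln (fact n)"
proof (cases "n = 0")
  case False
  then have "ln (real n ^ n) \<le> ln (exp (real n) * fact n)"
    using power_self_le_exp_fact[of n] by (subst ln_le_cancel_iff) auto
  then show ?thesis
    using False by (simp add: ln_mult ln_realpow algebra_simps)
qed simp

text \<open>Controls the loss \<open>ln (2 * m) + 1\<close> in the lower bound for
  \<open>ln (I\<^sub>m!)\<close>, so that a quarter of \<open>m * ln q\<close> survives.\<close>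

lemma ln_double_le:
  assumes "8 \<le> m"
  shows "ln (2 * real m) + 1 \<le> 3 / 4 * real m * ln 2"
proof -
  have "ln (1 / 2 :: real) \<le> 1 / 2 - 1"
    by (rule ln_le_minus_one) simp
  then have "1 / 2 \<le> ln (2 :: real)"
    by (simp add: ln_div)
  then have "real m * (1 / 2) \<le> real m * ln 2"
    by (intro mult_left_mono) auto
  moreover have "8 * ln 2 \<le> real m * ln 2"
    using assms by (intro mult_right_mono) auto
  \<comment> \<open>The tangent to \<open>ln\<close> at 32. The term \<open>5 * ln 2\<close> costs 5
    / 8 of \<open>m * ln 2\<close> by \<open>m \<ge> 8\<close>, and \<open>m / 16\<close> costs 1 /
    8 by \<open>ln 2 \<ge> 1 / 2\<close>; together 3 / 4.\<close>
  moreover have "ln (2 * real m) - 5 * ln 2 \<le> real m / 16 - 1"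
  proof -
    have "ln (2 * real m) - 5 * ln 2 = ln (2 * real m / 2 ^ 5)"
      using assms by (simp only: ln_div ln_realpow) (simp add: ln_div flip: ln_realpow)
    also have "\<dots> \<le> 2 * real m / 2 ^ 5 - 1"
      using assms by (intro ln_le_minus_one) simp
    finally show ?thesis by simp
  qed
  moreover have "3 / 4 * real m * ln 2 = 3 / 4 * (real m * ln 2)"
    by simp
  ultimately show ?thesis
    by linarith
qed

lemma log_num_constructed_sets_ge:
  "\<forall>\<^sub>F n in sequentially. real CARD('a::{finite, field}) ^ ((n - 1) div 2) / 8
    \<le> log CARD('a) (num_constructed_sets TYPE('a) n)"
proof -
  let ?Q = "real CARD('a)"
  have Q: "2 \<le> ?Q"
    using card_field_ge_2[where 'a = 'a] by simp
  show ?thesis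
    unfolding eventually_sequentially
  proof (intro exI allI impI)
    \<comment> \<open>The least \<open>n\<close> with \<open>(n - 1) div 2 \<ge> 8\<close>, as
      \<open>ln_double_le\<close> requires.\<close>
    fix n :: nat assume n: "17 \<le> n"
    define m where "m = (n - 1) div 2"
    define i where "i = num_irr TYPE('a) m"
    have "8 \<le> m"
      using n by (simp add: m_def)
    then have m: "4 \<le> m" "ln (2 * real m) + 1 \<le> 3 / 4 * real m * ln 2"
      using ln_double_le[OF \<open>8 \<le> m\<close>] by linarith+
    have i: "?Q ^ m / (2 * m) \<le> i"
      unfolding i_def by (rule num_irr_ge_half[OF m(1)])
    have pos: "0 < ?Q ^ m / (2 * m)"
      using Q m by simp
    have "real m * ln ?Q - ln (2 * real m) = ln (?Q ^ m / (2 * m))"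
      using Q m by (simp add: ln_div ln_realpow)
    also have "\<dots> \<le> ln i"
      using i pos by (subst ln_le_cancel_iff) auto
    finally have "real m * ln ?Q - 3 / 4 * real m * ln 2 \<le> ln i - 1"
      using m(2) by linarith
    moreover have "3 / 4 * real m * ln 2 \<le> 3 / 4 * real m * ln ?Q"
      using Q by (intro mult_left_mono) auto
    ultimately have ln_i: "real m / 4 * ln ?Q \<le> ln i - 1"
      by linarith
    \<comment> \<open>The denominator \<open>2 * m\<close> of the bound for \<open>i\<close> cancels
      against \<open>m / 4\<close> from \<open>ln i\<close>, leaving 1 / 8.\<close>
    have "?Q ^ m / 8 * ln ?Q = ?Q ^ m / (2 * m) * (real m / 4 * ln ?Q)"
      using m by (simp add: field_simps)
    also have "\<dots> \<le> i * (ln i - 1)"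
      using i ln_i pos Q by (intro mult_mono) auto
    also have "\<dots> \<le> ln (fact i)"
      by (rule ln_fact_ge)
    also have "\<dots> \<le> ln (real (num_constructed_sets TYPE('a) n))"
    proof -
      have "real (fact i) \<le> real (num_constructed_sets TYPE('a) n)"
        unfolding i_def m_def of_nat_le_iff using n by (intro num_constructed_sets_lower) simp
      then show ?thesis
        by (intro ln_mono) auto
    qed
    finally show "?Q ^ ((n - 1) div 2) / 8 \<le> log ?Q (num_constructed_sets TYPE('a) n)"
      using Q by (simp add: log_def m_def field_simps)
  qed
qed

text \<open>The rounded exponent lies between n / 2 - 1 and n / 2; the lower end, reached for even
  \<open>n\<close>, costs the factor \<open>1 / Q\<close>.\<close>

lemma power_half_bounds:
  assumes "1 \<le> Q" "0 < n"
  shows "Q powr (real n / 2) / Q \<le> Q ^ ((n - 1) div 2)" "Q ^ ((n - 1) div 2) \<le> Q powr (real n / 2)"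
proof -
  have "Q powr (real n / 2) / Q = Q powr (real n / 2 - 1)"
    using assms by (simp add: powr_diff)
  also have "\<dots> \<le> Q powr real ((n - 1) div 2)"
    using assms by (intro powr_mono) linarith+
  finally show "Q powr (real n / 2) / Q \<le> Q ^ ((n - 1) div 2)"
    using assms by (simp add: powr_realpow)
  have "Q powr real ((n - 1) div 2) \<le> Q powr (real n / 2)"
    using assms by (intro powr_mono) linarith+
  then show "Q ^ ((n - 1) div 2) \<le> Q powr (real n / 2)"
    using assms by (simp add: powr_realpow)
qed

lemma power_div_le_powr:
  assumes "1 \<le> (Q :: real)"
  shows "Q ^ (n div k) \<le> Q powr (real n / real k)"
proof -
  have "Q powr real (n div k) \<le> Q powr (real n / real k)"
    using assms by (intro powr_mono of_nat_div_le_of_nat) auto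
  then show ?thesis
    using assms by (simp add: powr_realpow)
qed

theorem theorem4:
  fixes q :: nat
  assumes "CARD('a::{finite, field}) = q"
  shows
    "(\<forall>n\<ge>1. real (num_constructed_sets TYPE('a) n) =
        (\<Prod>k = 1..nat \<lceil>real n / 2 - 1\<rceil>.
           fact (num_irr TYPE('a) (n - k)) /
           fact (num_irr TYPE('a) (n - k) - num_irr TYPE('a) k)))
     \<and> (\<lambda>n. log q (num_constructed_sets TYPE('a) n)) \<in> \<Theta>(\<lambda>n. real q powr (real n / 2))
     \<and> (\<lambda>n. log q (num_max_coprime_sets TYPE('a) n) - log q (num_constructed_sets TYPE('a) n))
         \<in> O(\<lambda>n. real q powr (real n / 3))
     \<and> (\<lambda>n. log q (num_max_coprime_sets TYPE('a) n)) \<in> \<Theta>(\<lambda>n. real q powr (real n / 2))"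
proof -
  let ?D = "\<lambda>n. num_constructed_sets TYPE('a) n" and ?T = "\<lambda>n. num_max_coprime_sets TYPE('a) n"
  have q: "2 \<le> q"
    using card_field_ge_2[where 'a = 'a] assms by simp
  have lower: "\<forall>\<^sub>F n in sequentially. 1 / (8 * real q) * (real q powr (real n / 2)) \<le> log q (?D n)"
    using log_num_constructed_sets_ge[where 'a = 'a] eventually_gt_at_top[of 0]
  proof eventually_elim
    case (elim n)
    have "1 / (8 * real q) * (real q powr (real n / 2)) = real q powr (real n / 2) / q / 8"
      by simp
    also have "\<dots> \<le> real q ^ ((n - 1) div 2) / 8"
      using q elim(2) by (intro divide_right_mono power_half_bounds(1)) auto
    also have "\<dots> \<le> log q (?D n)"
      using elim(1) unfolding assms .
    finally show ?case .
  qed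
  have D_le: "log q (?D n) \<le> 16 * real q powr (real n / 2)" if "3 \<le> n" for n
    using log_num_constructed_sets_le[OF that, where 'a = 'a] power_half_bounds(2)[of "real q" n] that q
    unfolding assms by simp
  have diff_le: "log q (?T n) - log q (?D n) \<le> 20 * real q powr (real n / 3)" if "3 \<le> n" for n
    using log_num_max_coprime_sets_diff_le[OF that, where 'a = 'a] power_div_le_powr[of "real q" n 3] q
    unfolding assms by simp
  have D_le_T: "log q (?D n) \<le> log q (?T n)" if "3 \<le> n" for n
    using num_constructed_sets_pos[of n, where 'a = 'a] num_constructed_sets_le_num_max[of n, where 'a = 'a] q that
    by (intro log_mono) auto
  have formula: "real (?D n) = (\<Prod>k = 1..nat \<lceil>real n / 2 - 1\<rceil>.
      fact (num_irr TYPE('a) (n - k)) / fact (num_irr TYPE('a) (n - k) - num_irr TYPE('a) k))"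
    if "1 \<le> n" for n
  proof -
    have "nat \<lceil>real n / 2 - 1\<rceil> = (n - 1) div 2"
      using that by linarith
    then show ?thesis
      using num_constructed_sets_formula[of n, where 'a = 'a] that by (simp only: less_eq_Suc_le One_nat_def)
  qed
  have "(\<lambda>n. log q (?D n)) \<in> \<Theta>(\<lambda>n. real q powr (real n / 2))"
  proof (rule bigthetaI')
    show "\<forall>\<^sub>F n in sequentially. 1 / (8 * real q) * norm (real q powr (real n / 2)) \<le> norm (log q (?D n))
        \<and> norm (log q (?D n)) \<le> 16 * norm (real q powr (real n / 2))"
      using lower eventually_ge_at_top[of 3]
    proof eventually_elim
      case (elim n)
      moreover have "0 \<le> 1 / (8 * real q) * (real q powr (real n / 2))"
        by simp
      ultimately have "0 \<le> log q (?D n)"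
        by linarith
      with elim show ?case
        using D_le[of n] by simp
    qed
  qed (use q in auto)
  moreover have "(\<lambda>n. log q (?T n) - log q (?D n)) \<in> O(\<lambda>n. real q powr (real n / 3))"
  proof (rule bigoI)
    show "\<forall>\<^sub>F n in sequentially. norm (log q (?T n) - log q (?D n)) \<le> 20 * norm (real q powr (real n / 3))"
      using eventually_ge_at_top[of 3]
    proof eventually_elim
      case (elim n)
      then show ?case
        using diff_le[of n] D_le_T[of n] by simp
    qed
  qed
  moreover have "(\<lambda>n. log q (?T n)) \<in> \<Theta>(\<lambda>n. real q powr (real n / 2))"
  proof (rule bigthetaI')
    \<comment> \<open>36 = 16 + 20 adds the constants of \<open>D_le\<close> and
      \<open>diff_le\<close>.\<close>
    show "\<forall>\<^sub>F n in sequentially. 1 / (8 * real q) * norm (real q powr (real n / 2)) \<le> norm (log q (?T n))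
        \<and> norm (log q (?T n)) \<le> 36 * norm (real q powr (real n / 2))"
      using lower eventually_ge_at_top[of 3]
    proof eventually_elim
      case (elim n)
      have "real q powr (real n / 3) \<le> real q powr (real n / 2)"
        using q by (intro powr_mono) auto
      moreover have "0 \<le> 1 / (8 * real q) * (real q powr (real n / 2))"
        by simp
      ultimately have "1 / (8 * real q) * (real q powr (real n / 2)) \<le> log q (?T n)" "0 \<le> log q (?T n)"
          "log q (?T n) \<le> 36 * real q powr (real n / 2)"
        using elim(1) D_le[OF elim(2)] D_le_T[OF elim(2)] diff_le[OF elim(2)] by linarith+
      then show ?case by simp
    qed
  qed (use q in auto)
  ultimately show ?thesis
    using formula by blast
qed

end
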